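(* Let $\mathbf{A}$ and $\mathbf{B}$ be two deterministic $k$-tuple and $\ell$-tuple of $N\times N$ matrices and $U$ be a Haar distributed unitary matrix. For any $n$ and any $C_1,\ldots,C_n \in \mathbf{A} \cup U\mathbf{B}U^*$, \begin{enumerate} \item for any $\sigma\in S_n$, if there exist two indices $i\neq j$ in the same cycle of $\sigma$ such that $C_i \in \mathbf{A}$ and $C_j \in U\mathbf{B}U^*$, then $\mathbb{E}[\kappa^N_{\sigma}(C_1,\ldots,C_n)]=0$, \item for any $0\leq m \leq n$, any $\sigma_1\in S_m$, any $\sigma_2\in S_{n-m}$, if $C_i \in \mathbf{A}$ for $i\in \{1,\ldots,m\}$ and $C_{j} \in U\mathbf{B}U^*$, i.e. $C_j = UB^{(c_j)}U^*$ for $j\in \{m+1,\ldots,n\}$, then $$\mathbb{E}[\kappa^{N}_{\sigma_1\otimes \sigma_2}(C_1,\ldots,C_n)]= \kappa^N_{\sigma_1}(C_1,\ldots,C_m)\kappa^N_{\sigma_2}\left(B^{(c_{m+1})},\ldots,B^{(c_{n})}\right).$$ \end{enumerate}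
   Context: The symmetric group $S_n$ acts on $(\mathbb{C}^N)^{\otimes n}$ by $\sigma. v_1\otimes\cdots\otimes v_n = v_{\sigma^{-1}(1)}\otimes\cdots\otimes v_{\sigma^{-1}(n)}$, and $\sigma$ also denotes the corresponding endomorphism. For $\sigma\in S_n$, $|\sigma| = n-\#\sigma$ where $\#\sigma$ is the number of cycles of $\sigma$. For matrices $M_1,\ldots,M_n\in M_N(\mathbb{C})$ and $U$ Haar distributed on the unitary group $U(N)$, the matricial cumulants $(\kappa^N_\sigma(\mathbf{M}))_{\sigma\in S_n}$ of $\mathbf{M}=(M_1,\ldots,M_n)$ are the coefficients such that $\mathbb{E}_U[(UM_1U^* )\otimes\cdots\otimes(UM_nU^* )] = \sum_{\sigma\in S_n} N^{-|\sigma|}\kappa^N_\sigma(\mathbf{M})\,\sigma$ in $\mathrm{End}((\mathbb{C}^N)^{\otimes n})$ (uniquely defined when $N\ge n$). When $M_1,\ldots,M_n$ are random, $\mathbb{E}[\kappa^N_\sigma(\mathbf{M})]$ is defined by $\mathbb{E}[(UM_1U^* )\otimes\cdots\otimes(UM_nU^* )] = \sum_{\sigma\in S_n} N^{-|\sigma|}\mathbb{E}[\kappa^N_\sigma(\mathbf{M})]\,\sigma$ with $U$ Haar distributed and independent of $M_1,\ldots,M_n$. For $\sigma_1\in S_m$, $\sigma_2\in S_{n-m}$, $\sigma_1\otimes\sigma_2\in S_n$ is the permutation with $\sigma_1\otimes\sigma_2(i)=\sigma_1(i)$ for $i\le m$ and $\sigma_1\otimes\sigma_2(m+i)=m+\sigma_2(i)$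 for $1\le i\le n-m$. *)

theory Defs
  imports "HOL-Probability.Probability" "HOL-Combinatorics.Combinatorics"
begin

type_synonym 'n cmat = "complex ^ 'n ^ 'n"

definition cadj :: "'n::finite cmat \<Rightarrow> 'n cmat" where
  "cadj U = (\<chi> i j. cnj (U $ j $ i))"

definition unitary_mat :: "'n::finite cmat \<Rightarrow> bool" where
  "unitary_mat U \<longleftrightarrow> U ** cadj U = mat 1"

definition haar_unitary :: "'n::finite cmat measure" where
  "haar_unitary = (THE \<mu>. prob_space \<mu> \<and> sets \<mu> = sets borel
      \<and> emeasure \<mu> {U. unitary_mat U} = 1
      \<and> (\<forall>V. unitary_mat V \<longrightarrow> distr \<mu> borel (\<lambda>U. V ** U) = \<mu>))"

definition num_cycles :: "nat \<Rightarrow> (nat \<Rightarrow> nat) \<Rightarrow> nat" where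
  "num_cycles n \<sigma> = card ((\<lambda>k. orbit \<sigma> k) ` {..<n})"

definition perm_length :: "nat \<Rightarrow> (nat \<Rightarrow> nat) \<Rightarrow> nat" where
  "perm_length n \<sigma> = n - num_cycles n \<sigma>"

text \<open>Matrix entries of the endomorphism sigma of (C^N)^{\<otimes> n} in the basis
  e_{i_0} \<otimes> ... \<otimes> e_{i_{n-1}}; multi-indices are functions nat \<Rightarrow> 'n
  (only the values below n matter).
  sigma.(v_1 \<otimes> ... \<otimes> v_n) = v_{sigma^-1(1)} \<otimes> ... \<otimes> v_{sigma^-1(n)}.\<close>
definition perm_entry :: "nat \<Rightarrow> (nat \<Rightarrow> nat) \<Rightarrow> (nat \<Rightarrow> 'n) \<Rightarrow> (nat \<Rightarrow> 'n) \<Rightarrow> complex" where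
  "perm_entry n \<sigma> i j = (\<Prod>k<n. if i k = j (inv \<sigma> k) then 1 else 0)"

definition is_cumulant_family ::
  "nat \<Rightarrow> ((nat \<Rightarrow> 'n::finite) \<Rightarrow> (nat \<Rightarrow> 'n) \<Rightarrow> complex) \<Rightarrow> ((nat \<Rightarrow> nat) \<Rightarrow> complex) \<Rightarrow> bool" where
  "is_cumulant_family n T c \<longleftrightarrow>
     (\<forall>\<sigma>. \<not> \<sigma> permutes {..<n} \<longrightarrow> c \<sigma> = 0) \<and>
     (\<forall>i j. T i j = (\<Sum>\<sigma>\<in>{\<sigma>. \<sigma> permutes {..<n}}.
         (of_nat CARD('n)) powi (- int (perm_length n \<sigma>)) * c \<sigma> * perm_entry n \<sigma> i j))"

definition mat_cumulant :: "(nat \<Rightarrow> 'n::finite cmat) \<Rightarrow> nat \<Rightarrow> (nat \<Rightarrow> nat) \<Rightarrow> complex" where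
  "mat_cumulant M n = (THE c. is_cumulant_family n
      (\<lambda>i j. \<integral>U. (\<Prod>k<n. (U ** M k ** cadj U) $ i k $ j k) \<partial>haar_unitary) c)"

text \<open>Expected matricial cumulants E[kappa^N_sigma(M)] of a random tuple M defined on
  the probability space P; the Haar unitary U is independent (product measure).\<close>
definition exp_mat_cumulant ::
  "'w measure \<Rightarrow> ('w \<Rightarrow> nat \<Rightarrow> 'n::finite cmat) \<Rightarrow> nat \<Rightarrow> (nat \<Rightarrow> nat) \<Rightarrow> complex" where
  "exp_mat_cumulant P M n = (THE c. is_cumulant_family n
      (\<lambda>i j. \<integral>p. (\<Prod>k<n. (snd p ** M (fst p) k ** cadj (snd p)) $ i k $ j k)
               \<partial>(P \<Otimes>\<^sub>M haar_unitary)) c)"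

definition perm_tensor :: "nat \<Rightarrow> (nat \<Rightarrow> nat) \<Rightarrow> (nat \<Rightarrow> nat) \<Rightarrow> nat \<Rightarrow> nat" where
  "perm_tensor m \<sigma>1 \<sigma>2 i = (if i < m then \<sigma>1 i else m + \<sigma>2 (i - m))"

end

theory Submission
  imports Defs
begin

text \<open>
  Averaging over the Haar measure makes the tensor \<open>T i j = E \<Prod>\<^sub>k (U M\<^sub>k U\<^sup>*)\<^bsub>i\<^sub>k j\<^sub>k\<^esub>\<close>
  invariant under conjugation by unitaries, hence, by differentiation and complexification, under the
  derivations given by all matrix units. If \<open>n \<le> N\<close>, pick \<open>j\<^sub>0\<close> injective. The diagonal matrix units
  force \<open>T i j\<^sub>0 = 0\<close> unless \<open>i\<close> is a rearrangement of \<open>j\<^sub>0\<close>, and the off-diagonal ones show that an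
  invariant tensor is determined by its column \<open>j\<^sub>0\<close>. So \<open>T\<close> is a unique combination of permutations, with
  cumulants \<open>N\<^bsup>|\<sigma>|\<^esup> T (j\<^sub>0 \<circ> \<sigma>\<^sup>-\<^sup>1) j\<^sub>0\<close>.
  For \<open>C\<^sub>i \<in> A \<union> U B U\<^sup>*\<close>, left invariance replaces \<open>V U\<close> by an independent Haar unitary, so the
  tensor is the product of an \<open>A\<close>-tensor and a \<open>B\<close>-tensor. The second claim can then be read off, and the
  first holds because a cycle mixing both kinds of indices makes the \<open>A\<close>-factor vanish.
\<close>

section \<open>Complex matrices and unitaries\<close>

lemma norm_vec_sq: "(norm x)\<^sup>2 = (\<Sum>i\<in>UNIV. (norm (x $ i))\<^sup>2)"
  for x :: "'a::real_normed_vector ^ 'n::finite"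
  by (simp add: norm_vec_def L2_set_def sum_nonneg)

lemma norm_matrix_sq: "(norm A)\<^sup>2 = (\<Sum>i\<in>UNIV. \<Sum>j\<in>UNIV. (norm (A $ i $ j))\<^sup>2)"
  for A :: "'a::real_normed_vector ^ 'n::finite ^ 'm::finite"
  by (simp add: norm_vec_sq)

text \<open>The norm of a vector of vectors is the Frobenius norm, so Cauchy-Schwarz applied to each
  entry of the product gives submultiplicativity.\<close>

lemma norm_matrix_mult_le: "norm (A ** B) \<le> norm A * norm B"
  for A :: "'a::real_normed_field ^ 'n::finite ^ 'm::finite" and B :: "'a ^ 'p::finite ^ 'n"
proof -
  have entry: "(norm ((A ** B) $ i $ j))\<^sup>2 \<le> (norm (A $ i))\<^sup>2 * (\<Sum>k\<in>UNIV. (norm (B $ k $ j))\<^sup>2)" for i j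
  proof -
    have "norm ((A ** B) $ i $ j) \<le> (\<Sum>k\<in>UNIV. \<bar>norm (A $ i $ k)\<bar> * \<bar>norm (B $ k $ j)\<bar>)"
      unfolding matrix_matrix_mult_def by (simp add: norm_mult[symmetric] norm_sum)
    also have "\<dots> \<le> L2_set (\<lambda>k. norm (A $ i $ k)) UNIV * L2_set (\<lambda>k. norm (B $ k $ j)) UNIV"
      by (rule L2_set_mult_ineq)
    finally have "(norm ((A ** B) $ i $ j))\<^sup>2
        \<le> (L2_set (\<lambda>k. norm (A $ i $ k)) UNIV * L2_set (\<lambda>k. norm (B $ k $ j)) UNIV)\<^sup>2"
      by (intro power_mono) auto
    then show ?thesis
      by (simp add: power_mult_distrib L2_set_def sum_nonneg norm_vec_sq)
  qed
  have "(norm (A ** B))\<^sup>2 \<le> (\<Sum>i\<in>UNIV. \<Sum>j\<in>UNIV. (norm (A $ i))\<^sup>2 * (\<Sum>k\<in>UNIV. (norm (B $ k $ j))\<^sup>2))"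
    unfolding norm_matrix_sq by (intro sum_mono entry)
  also have "\<dots> = (\<Sum>i\<in>UNIV. (norm (A $ i))\<^sup>2) * (\<Sum>j\<in>UNIV. \<Sum>k\<in>UNIV. (norm (B $ k $ j))\<^sup>2)"
    by (simp only: sum_product)
  also have "(\<Sum>j\<in>UNIV. \<Sum>k\<in>UNIV. (norm (B $ k $ j))\<^sup>2) = (norm B)\<^sup>2"
    unfolding norm_matrix_sq by (rule sum.swap)
  also have "(\<Sum>i\<in>UNIV. (norm (A $ i))\<^sup>2) = (norm A)\<^sup>2"
    by (rule norm_vec_sq[symmetric])
  finally show ?thesis
    by (simp add: power_mult_distrib[symmetric] abs_le_square_iff[symmetric] abs_mult)
qed

text \<open>Source of the continuity and limit rules for matrix products used below.\<close>

lemma bounded_bilinear_matrix_mult: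
  "bounded_bilinear ((**) :: 'a::real_normed_field ^ 'n::finite ^ 'm::finite \<Rightarrow> 'a ^ 'p::finite ^ 'n \<Rightarrow> _)"
proof
  show "\<exists>K. \<forall>(A :: 'a ^ 'n ^ 'm) (B :: 'a ^ 'p ^ 'n). norm (A ** B) \<le> norm A * norm B * K"
    by (rule exI[of _ 1]) (simp add: norm_matrix_mult_le)
qed (simp_all add: vec_eq_iff matrix_matrix_mult_def algebra_simps sum.distrib scaleR_sum_right)

interpretation matrix_mult: bounded_bilinear
  "(**) :: 'a::real_normed_field ^ 'n::finite ^ 'm::finite \<Rightarrow> 'a ^ 'p::finite ^ 'n \<Rightarrow> _"
  by (rule bounded_bilinear_matrix_mult)

lemma bounded_linear_cadj: "bounded_linear (cadj :: 'n::finite cmat \<Rightarrow> _)"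
proof
  have "norm (cadj A) = norm A" for A :: "'n cmat"
  proof -
    have "(norm (cadj A))\<^sup>2 = (norm A)\<^sup>2"
      unfolding norm_matrix_sq cadj_def by (subst sum.swap) simp
    then show ?thesis by simp
  qed
  then show "\<exists>K. \<forall>A :: 'n cmat. norm (cadj A) \<le> norm A * K"
    by (intro exI[of _ 1]) simp
qed (simp_all add: cadj_def vec_eq_iff)

lemma cadj_add: "cadj (A + B) = cadj A + cadj B"
  and cadj_diff: "cadj (A - B) = cadj A - cadj B"
  and cadj_scaleR: "cadj (r *\<^sub>R A) = r *\<^sub>R cadj A"
  by (simp_all add: cadj_def vec_eq_iff)

lemmas continuous_on_cadj [continuous_intros] = bounded_linear.continuous_on[OF bounded_linear_cadj]
lemmas continuous_on_matrix_mult [continuous_intros] =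
  bounded_bilinear.continuous_on[OF bounded_bilinear_matrix_mult]

lemma cadj_cadj [simp]: "cadj (cadj A) = A"
  by (simp add: cadj_def vec_eq_iff)

lemma cadj_matrix_mult: "cadj (A ** B) = cadj B ** cadj A"
  by (simp add: cadj_def vec_eq_iff matrix_matrix_mult_def mult.commute)

lemma cadj_mat_1 [simp]: "cadj (mat 1) = mat 1"
  by (auto simp: cadj_def vec_eq_iff mat_def)

lemma unitary_matD:
  assumes "unitary_mat U"
  shows "U ** cadj U = mat 1" "cadj U ** U = mat 1"
  using assms matrix_left_right_inverse unfolding unitary_mat_def by blast+

lemma unitary_mat_iff_cadj_left: "unitary_mat U \<longleftrightarrow> cadj U ** U = mat 1"
  using matrix_left_right_inverse unfolding unitary_mat_def by blast

lemma unitary_mat_cadj: "unitary_mat U \<Longrightarrow> unitary_mat (cadj U)"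
  by (simp add: unitary_matD unitary_mat_def)

text \<open>Whatever depends on \<open>X\<close> only through \<open>cadj X ** X\<close>, such as
  the norm and the defect below, is therefore unchanged by left multiplication with a
  unitary.\<close>

lemma cadj_mult_unitary:
  assumes "unitary_mat V"
  shows "cadj (V ** X) ** (V ** X) = cadj X ** X"
proof -
  have "cadj (V ** X) ** (V ** X) = cadj X ** (cadj V ** V) ** X"
    by (simp add: cadj_matrix_mult matrix_mul_assoc)
  then show ?thesis by (simp add: unitary_matD[OF assms])
qed

lemma norm_sq_eq_trace: "(norm X)\<^sup>2 = Re (trace (cadj X ** X))"
proof -
  have "Re (trace (cadj X ** X)) = (\<Sum>j\<in>UNIV. \<Sum>i\<in>UNIV. (norm (X $ i $ j))\<^sup>2)"
    by (simp add: trace_def matrix_matrix_mult_def cadj_def cmod_power2 flip: power2_eq_square)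
  then show ?thesis
    unfolding norm_matrix_sq by (subst sum.swap) simp
qed

lemma norm_unitary_mult: "unitary_mat V \<Longrightarrow> norm (V ** X) = norm X" for X :: "'n::finite cmat"
  by (rule power2_eq_imp_eq) (simp_all add: norm_sq_eq_trace cadj_mult_unitary)

lemma closed_unitary: "closed {U :: 'n::finite cmat. unitary_mat U}"
  unfolding unitary_mat_def
  by (intro closed_Collect_eq continuous_intros)

text \<open>All unitaries have the norm of the identity, hence boundedness. Compactness later makes
  continuous functions integrable for the Haar measure.\<close>

lemma compact_unitary: "compact {U :: 'n::finite cmat. unitary_mat U}"
proof -
  have "norm U = norm (mat 1 :: 'n cmat)" if "unitary_mat U" for U :: "'n cmat"
    using norm_unitary_mult[OF that, of "mat 1"] by simp
  then show ?thesis
    unfolding compact_eq_bounded_closed using closed_unitary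
    by (auto simp: bounded_iff intro!: exI[of _ "norm (mat 1 :: 'n cmat)"])
qed

section \<open>Borel measurability of the matrix operations\<close>

lemma borel_measurable_matrix_mult [measurable (raw)]:
  fixes f g :: "'a \<Rightarrow> 'n::finite cmat"
  assumes "f \<in> borel_measurable M" "g \<in> borel_measurable M"
  shows "(\<lambda>x. f x ** g x) \<in> borel_measurable M"
  using assms by (rule borel_measurable_continuous_Pair)
    (intro continuous_intros)

lemma borel_measurable_matrix_mult_left [measurable]:
  "(**) V \<in> borel_measurable (borel :: 'n::finite cmat measure)"
  by (rule borel_measurable_continuous_onI) (intro continuous_intros)

lemma borel_measurable_cadj [measurable (raw)]:
  fixes f :: "'a \<Rightarrow> 'n::finite cmat"
  assumes "f \<in> borel_measurable M"
  shows "(\<lambda>x. cadj (f x)) \<in> borel_measurable M"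
  by (rule borel_measurable_continuous_on[OF _ assms]) (intro continuous_intros)

lemma borel_measurable_vec_nth [measurable (raw)]:
  fixes f :: "'a \<Rightarrow> 'b::euclidean_space ^ 'n::finite"
  assumes "f \<in> borel_measurable M"
  shows "(\<lambda>x. f x $ i) \<in> borel_measurable M"
  by (rule borel_measurable_continuous_on[OF _ assms]) (intro continuous_intros)

lemma unitary_set_measurable [measurable]: "{U :: 'n::finite cmat. unitary_mat U} \<in> sets borel"
  by (rule borel_closed[OF closed_unitary])

lemma unitary_pred_measurable [measurable]: "Measurable.pred borel (unitary_mat :: 'n::finite cmat \<Rightarrow> bool)"
  by (simp add: pred_def)

section \<open>A unitary factor by Newton--Schulz iteration\<close>

definition unitary_defect :: "'n::finite cmat \<Rightarrow> 'n cmat" where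
  "unitary_defect X = mat 1 - cadj X ** X"

text \<open>This is X(3 - X'X)/2 with X' the adjoint, the Newton-Schulz step towards the unitary
  factor of the polar decomposition; it needs no inverse and no square root.\<close>

definition schulz_step :: "'n::finite cmat \<Rightarrow> 'n cmat" where
  "schulz_step X = X ** (mat 1 + (1/2) *\<^sub>R unitary_defect X)"

definition unitary_part :: "'n::finite cmat \<Rightarrow> 'n cmat" where
  "unitary_part X = lim (\<lambda>k. (schulz_step ^^ k) X)"

lemma unitary_defect_unitary_mult: "unitary_mat V \<Longrightarrow> unitary_defect (V ** X) = unitary_defect X"
  by (simp add: unitary_defect_def cadj_mult_unitary)

lemma schulz_step_unitary_mult: "unitary_mat V \<Longrightarrow> schulz_step (V ** X) = V ** schulz_step X"
  by (simp add: schulz_step_def unitary_defect_unitary_mult matrix_mul_assoc)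

lemma schulz_iter_unitary_mult:
  "unitary_mat V \<Longrightarrow> (schulz_step ^^ k) (V ** X) = V ** (schulz_step ^^ k) X"
  by (induction k) (simp_all add: schulz_step_unitary_mult)

text \<open>With E the defect, (1 + E/2)(1 - E)(1 + E/2) = 1 - 3/4 E^2 - 1/4 E^3. The linear term
  cancels, so the defect shrinks quadratically.\<close>

lemma unitary_defect_schulz_step:
  fixes X :: "'n::finite cmat"
  defines "E \<equiv> unitary_defect X"
  shows "unitary_defect (schulz_step X) = (3/4) *\<^sub>R (E ** E) + (1/4) *\<^sub>R (E ** E ** E)"
proof -
  let ?H = "mat 1 + (1/2) *\<^sub>R E"
  have cE: "cadj E = E"
    by (simp add: E_def unitary_defect_def cadj_diff cadj_matrix_mult)
  have P: "cadj X ** X = mat 1 - E"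
    by (simp add: E_def unitary_defect_def)
  have "cadj (schulz_step X) ** schulz_step X = cadj ?H ** (cadj X ** X) ** ?H"
    by (simp add: schulz_step_def E_def cadj_matrix_mult matrix_mul_assoc)
  also have "\<dots> = ?H ** (mat 1 - E) ** ?H"
    by (simp add: P cE cadj_add cadj_scaleR)
  also have "\<dots> = mat 1 - ((3/4) *\<^sub>R (E ** E) + (1/4) *\<^sub>R (E ** E ** E))"
    by (simp add: matrix_mult.add_left matrix_mult.add_right matrix_mult.diff_left
        matrix_mult.diff_right matrix_mult.scaleR_left matrix_mult.scaleR_right matrix_mul_assoc)
      (simp add: vec_eq_iff complex_eq_iff algebra_simps)
  finally show ?thesis by (simp add: unitary_defect_def)
qed

text \<open>For e at most 1/2, the bound 3/4 e^2 + 1/4 e^3 is at most (3/8 + 1/16) e, which is below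
  e/2.\<close>

lemma norm_unitary_defect_schulz_step:
  assumes "norm (unitary_defect X) \<le> 1/2"
  shows "norm (unitary_defect (schulz_step X)) \<le> norm (unitary_defect X) / 2"
proof -
  let ?E = "unitary_defect X" and ?e = "norm (unitary_defect X)"
  have E2: "norm (?E ** ?E) \<le> ?e * ?e"
    by (rule norm_matrix_mult_le)
  have "norm (?E ** ?E ** ?E) \<le> norm (?E ** ?E) * ?e"
    by (rule norm_matrix_mult_le)
  also have "\<dots> \<le> (?e * ?e) * ?e"
    by (intro mult_right_mono E2) simp
  finally have E3: "norm (?E ** ?E ** ?E) \<le> (?e * ?e) * ?e" .
  have sq: "?e * ?e \<le> 1/2 * ?e"
    using assms by (intro mult_right_mono) auto
  have "(?e * ?e) * ?e \<le> (1/2 * ?e) * (1/2)"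
    using sq assms by (intro mult_mono) auto
  then have cube: "(?e * ?e) * ?e \<le> 1/4 * ?e" by simp
  have "norm (unitary_defect (schulz_step X)) \<le> 3/4 * norm (?E ** ?E) + 1/4 * norm (?E ** ?E ** ?E)"
    unfolding unitary_defect_schulz_step by (rule order_trans[OF norm_triangle_ineq]) simp
  also have "\<dots> \<le> ?e / 2"
    using E2 E3 sq cube norm_ge_zero[of ?E] by linarith
  finally show ?thesis .
qed

lemma norm_unitary_defect_schulz_iter:
  assumes "norm (unitary_defect X) \<le> 1/2"
  shows "norm (unitary_defect ((schulz_step ^^ k) X)) \<le> (1/2) ^ Suc k"
proof (induction k)
  case 0
  show ?case using assms by simp
next
  case (Suc k)
  have "(1/2 :: real) ^ Suc k \<le> 1/2"
    by (simp add: power_le_one)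
  then show ?case
    using norm_unitary_defect_schulz_step[of "(schulz_step ^^ k) X"] Suc by auto
qed

text \<open>The squared norm is the trace of \<open>cadj X ** X\<close>, whose diagonal entries
  differ from 1 by at most the norm of the defect. This bounds all iterates uniformly.\<close>

lemma norm_le_of_unitary_defect:
  fixes X :: "'n::finite cmat"
  assumes "norm (unitary_defect X) \<le> 1"
  shows "(norm X)\<^sup>2 \<le> 2 * CARD('n)"
proof -
  have diag: "Re ((cadj X ** X) $ i $ i) \<le> 2" for i
  proof -
    have "norm (unitary_defect X $ i $ i) \<le> norm (unitary_defect X)"
      by (rule order_trans[OF Finite_Cartesian_Product.norm_nth_le Finite_Cartesian_Product.norm_nth_le])
    then have "\<bar>Re (unitary_defect X $ i $ i)\<bar> \<le> 1"
      using abs_Re_le_cmod[of "unitary_defect X $ i $ i"] assms by linarith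
    then show ?thesis
      by (simp add: unitary_defect_def mat_def)
  qed
  have "(norm X)\<^sup>2 = (\<Sum>i\<in>UNIV. Re ((cadj X ** X) $ i $ i))"
    by (simp add: norm_sq_eq_trace trace_def)
  also have "\<dots> \<le> (\<Sum>i\<in>(UNIV :: 'n set). 2)"
    by (intro sum_mono diag)
  finally show ?thesis by simp
qed

text \<open>Consecutive iterates differ by a bounded factor times half the defect, hence by a
  geometric term; the telescoping series of differences converges.\<close>

lemma schulz_iter_convergent:
  fixes X :: "'n::finite cmat"
  assumes "norm (unitary_defect X) \<le> 1/2"
  shows "convergent (\<lambda>k. (schulz_step ^^ k) X)"
proof -
  define Y where "Y k = (schulz_step ^^ k) X" for k
  define K where "K = sqrt (2 * CARD('n))"
  have step: "norm (Y (Suc k) - Y k) \<le> K * (1/2) ^ k" for k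
  proof -
    have E: "norm (unitary_defect (Y k)) \<le> (1/2) ^ Suc k"
      unfolding Y_def by (rule norm_unitary_defect_schulz_iter[OF assms])
    also have "\<dots> \<le> (1::real)" by (intro power_le_one) auto
    finally have "(norm (Y k))\<^sup>2 \<le> 2 * CARD('n)"
      by (rule norm_le_of_unitary_defect)
    then have K: "norm (Y k) \<le> K"
      unfolding K_def by (rule real_le_rsqrt)
    have "Y (Suc k) - Y k = Y k ** ((1/2) *\<^sub>R unitary_defect (Y k))"
      by (simp add: Y_def schulz_step_def matrix_mult.add_right)
    also have "norm \<dots> \<le> norm (Y k) * norm ((1/2) *\<^sub>R unitary_defect (Y k))"
      by (rule norm_matrix_mult_le)
    also have "\<dots> \<le> K * (1/2) ^ k"
    proof (rule mult_mono)
      have "norm ((1/2) *\<^sub>R unitary_defect (Y k)) \<le> norm (unitary_defect (Y k))" by simp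
      also have "\<dots> \<le> (1/2) ^ k" using E by (rule order_trans) simp
      finally show "norm ((1/2) *\<^sub>R unitary_defect (Y k)) \<le> (1/2) ^ k" .
    qed (use K in \<open>simp_all add: K_def\<close>)
    finally show ?thesis .
  qed
  have "summable (\<lambda>k. Y (Suc k) - Y k)"
    by (rule summable_comparison_test'[OF summable_mult[OF summable_geometric[of "1/2 :: real"]]])
      (use step in auto)
  then have "(\<lambda>k. (\<Sum>i<k. Y (Suc i) - Y i) + Y 0) \<longlonglongrightarrow> suminf (\<lambda>k. Y (Suc k) - Y k) + Y 0"
    by (intro tendsto_intros summable_LIMSEQ)
  then have "Y \<longlonglongrightarrow> suminf (\<lambda>k. Y (Suc k) - Y k) + Y 0"
    by (simp add: sum_lessThan_telescope)
  then show ?thesis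
    unfolding Y_def[abs_def] by (auto simp: convergent_def)
qed

lemma schulz_iter_tendsto:
  assumes "norm (unitary_defect X) \<le> 1/2"
  shows "(\<lambda>k. (schulz_step ^^ k) X) \<longlonglongrightarrow> unitary_part X"
  using schulz_iter_convergent[OF assms] by (simp add: unitary_part_def convergent_LIMSEQ_iff)

lemma unitary_part_unitary:
  fixes X :: "'n::finite cmat"
  assumes "norm (unitary_defect X) \<le> 1/2"
  shows "unitary_mat (unitary_part X)"
proof -
  let ?Y = "\<lambda>k. (schulz_step ^^ k) X"
  have "(\<lambda>k. unitary_defect (?Y k)) \<longlonglongrightarrow> unitary_defect (unitary_part X)"
    unfolding unitary_defect_def
    by (intro tendsto_intros matrix_mult.tendsto bounded_linear.tendsto[OF bounded_linear_cadj]
        schulz_iter_tendsto[OF assms])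
  moreover have "(\<lambda>k. unitary_defect (?Y k)) \<longlonglongrightarrow> 0"
  proof (rule Lim_null_comparison)
    show "\<forall>\<^sub>F k in sequentially. norm (unitary_defect (?Y k)) \<le> (1/2) ^ Suc k"
      by (intro always_eventually allI norm_unitary_defect_schulz_iter assms)
    show "(\<lambda>k. (1/2 :: real) ^ Suc k) \<longlonglongrightarrow> 0"
      by (intro LIMSEQ_Suc LIMSEQ_power_zero) simp
  qed
  ultimately have "unitary_defect (unitary_part X) = 0"
    by (rule LIMSEQ_unique)
  then show ?thesis
    by (simp add: unitary_defect_def unitary_mat_iff_cadj_left)
qed

lemma unitary_part_unitary_mult:
  assumes "norm (unitary_defect X) \<le> 1/2" "unitary_mat V"
  shows "unitary_part (V ** X) = V ** unitary_part X"
proof -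
  have "(\<lambda>k. (schulz_step ^^ k) (V ** X)) \<longlonglongrightarrow> V ** unitary_part X"
    unfolding schulz_iter_unitary_mult[OF assms(2)]
    by (intro matrix_mult.tendsto tendsto_const schulz_iter_tendsto assms)
  then show ?thesis
    by (simp add: unitary_part_def limI)
qed

lemma continuous_on_unitary_defect [continuous_intros]:
  "continuous_on S f \<Longrightarrow> continuous_on S (\<lambda>x. unitary_defect (f x))"
  unfolding unitary_defect_def by (intro continuous_intros)

text \<open>A limit of continuous iterates. Measurability holds on the whole space, although the
  iteration is only known to converge where the defect is small.\<close>

lemma borel_measurable_unitary_part [measurable]:
  "unitary_part \<in> borel_measurable (borel :: 'n::finite cmat measure)"
proof -
  have cont: "continuous_on UNIV (schulz_step :: 'n cmat \<Rightarrow> _)"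
    unfolding schulz_step_def[abs_def] by (intro continuous_intros)
  have "continuous_on UNIV ((schulz_step :: 'n cmat \<Rightarrow> _) ^^ k)" for k
    by (induction k) (auto intro!: continuous_on_compose2[OF cont] simp: o_def id_def)
  then have [measurable]: "(schulz_step :: 'n cmat \<Rightarrow> _) ^^ k \<in> borel_measurable borel" for k
    by (rule borel_measurable_continuous_onI)
  show ?thesis
    unfolding unitary_part_def[abs_def] by measurable
qed

section \<open>Existence and uniqueness of the Haar measure\<close>

lemma nn_integral_lborel_reflect:
  fixes f :: "'a::euclidean_space \<Rightarrow> ennreal"
  assumes [measurable]: "f \<in> borel_measurable borel"
  shows "(\<integral>\<^sup>+y. f (x - y) \<partial>lborel) = (\<integral>\<^sup>+y. f y \<partial>lborel)"
proof -
  have "lborel = distr lborel borel (\<lambda>y. x - y)"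
    using lborel_affine[of "-1" x] by (simp add: density_1)
  then have "(\<integral>\<^sup>+y. f y \<partial>lborel) = (\<integral>\<^sup>+y. f y \<partial>distr lborel borel (\<lambda>y. x - y))"
    by simp
  also have "\<dots> = (\<integral>\<^sup>+y. f (x - y) \<partial>lborel)"
    by (rule nn_integral_distr) auto
  finally show ?thesis by simp
qed

text \<open>A double integral of \<open>indicator A x * indicator B (x - y)\<close> is evaluated in
  both orders. The cross-multiplied form of proportionality avoids division in
  \<open>ennreal\<close>.\<close>

lemma translation_invariant_unique:
  fixes M :: "'a::euclidean_space measure"
  assumes "sigma_finite_measure M" and sets_M [measurable_cong]: "sets M = sets borel"
    and trans: "\<And>x. distr M borel (\<lambda>y. x + y) = M"
    and [measurable]: "A \<in> sets borel" "B \<in> sets borel"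
  shows "emeasure M A * emeasure lborel B = emeasure M B * emeasure lborel A"
proof -
  interpret M: sigma_finite_measure M by fact
  interpret pair_sigma_finite M lborel
    by standard
  let ?I = "\<lambda>A x. indicator A x :: ennreal"
  have shift: "(\<integral>\<^sup>+x. f (y + x) \<partial>M) = (\<integral>\<^sup>+x. f x \<partial>M)"
    if [measurable]: "f \<in> borel_measurable borel" for f y
  proof -
    have "(\<integral>\<^sup>+x. f x \<partial>M) = (\<integral>\<^sup>+x. f x \<partial>distr M borel (\<lambda>x. y + x))"
      by (simp add: trans)
    then show ?thesis by (subst (asm) nn_integral_distr) auto
  qed
  \<comment> \<open>For fixed \<open>x\<close>, the reflection \<open>y\<close> to
    \<open>x - y\<close> preserves Lebesgue measure, so the inner integral contributes the measure
    of \<open>B\<close>.\<close>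
  have "emeasure M A * emeasure lborel B = (\<integral>\<^sup>+x. \<integral>\<^sup>+y. ?I A x * ?I B (x - y) \<partial>lborel \<partial>M)"
    by (simp add: nn_integral_cmult nn_integral_multc nn_integral_lborel_reflect sets_M)
  also have "\<dots> = (\<integral>\<^sup>+y. \<integral>\<^sup>+x. ?I A x * ?I B (x - y) \<partial>M \<partial>lborel)"
    by (rule Fubini'[symmetric]) measurable
  \<comment> \<open>For fixed \<open>y\<close>, invariance of \<open>M\<close> allows
    \<open>x\<close> to be replaced by \<open>y + x\<close>, which frees the factor for
    \<open>B\<close> from \<open>y\<close>.\<close>
  also have "\<dots> = (\<integral>\<^sup>+y. \<integral>\<^sup>+x. ?I A (y + x) * ?I B x \<partial>M \<partial>lborel)"
  proof (rule nn_integral_cong)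
    fix y
    show "(\<integral>\<^sup>+x. ?I A x * ?I B (x - y) \<partial>M) = (\<integral>\<^sup>+x. ?I A (y + x) * ?I B x \<partial>M)"
      using shift[of "\<lambda>x. ?I A x * ?I B (x - y)" y] by simp
  qed
  also have "\<dots> = (\<integral>\<^sup>+x. \<integral>\<^sup>+y. ?I A (y + x) * ?I B x \<partial>lborel \<partial>M)"
    by (rule Fubini') measurable
  also have "\<dots> = (\<integral>\<^sup>+x. (\<integral>\<^sup>+y. ?I A (y + x) \<partial>lborel) * ?I B x \<partial>M)"
    by (simp add: nn_integral_multc)
  also have "\<dots> = (\<integral>\<^sup>+x. emeasure lborel A * ?I B x \<partial>M)"
  proof -
    have "(\<integral>\<^sup>+y. ?I A (y + x) \<partial>lborel) = emeasure lborel A" for x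
    proof -
      have "(\<integral>\<^sup>+y. ?I A (y + x) \<partial>lborel) = (\<integral>\<^sup>+y. ?I A (x - (0 - y)) \<partial>lborel)"
        by (simp add: add.commute)
      also have "\<dots> = (\<integral>\<^sup>+y. ?I A (x - y) \<partial>lborel)"
        by (rule nn_integral_lborel_reflect) measurable
      also have "\<dots> = emeasure lborel A"
        by (subst nn_integral_lborel_reflect) auto
      finally show ?thesis .
    qed
    then show ?thesis by simp
  qed
  also have "\<dots> = emeasure M B * emeasure lborel A"
    by (simp add: nn_integral_cmult sets_M) (simp add: mult.commute)
  finally show ?thesis .
qed

text \<open>The image measure is again translation invariant, hence proportional to Lebesgue
  measure. The unit ball is its own preimage and has positive finite measure, so the factor is
  1.\<close>

lemma lborel_linear_isometry_invariant:
  fixes f g :: "'a::euclidean_space \<Rightarrow> 'a"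
  assumes f: "linear f" "\<And>x. norm (f x) = norm x" and g: "linear g" "\<And>x. f (g x) = x" "\<And>x. g (f x) = x"
  shows "distr lborel borel f = lborel"
proof -
  have f_meas [measurable]: "f \<in> borel_measurable borel" and g_meas [measurable]: "g \<in> borel_measurable borel"
    using f g by (auto intro!: borel_measurable_continuous_onI linear_continuous_on simp: linear_conv_bounded_linear)
  let ?M = "distr lborel borel f"
  \<comment> \<open>Pushing back along the inverse recovers \<open>lborel\<close>, from which the
    image measure inherits sigma-finiteness.\<close>
  have "distr ?M borel g = lborel"
    by (subst distr_distr) (auto simp: o_def g distr_id2)
  then have sf: "sigma_finite_measure ?M"
    by (intro sigma_finite_measure_distr[of ?M borel g]) (simp_all add: sigma_finite_lborel)
  have trans: "distr ?M borel (\<lambda>y. x + y) = ?M" for x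
  proof -
    have "lborel = distr lborel borel (\<lambda>y. g x + y)"
      using lborel_affine[of 1 "g x"] by (simp add: density_1)
    then have "?M = distr (distr lborel borel (\<lambda>y. g x + y)) borel f"
      by simp
    also have "\<dots> = distr lborel borel (\<lambda>y. x + f y)"
      by (subst distr_distr) (auto simp: o_def linear_add[OF f(1)] g)
    also have "\<dots> = distr ?M borel (\<lambda>y. x + y)"
      by (subst distr_distr) (auto simp: o_def)
    finally show ?thesis by simp
  qed
  let ?B = "ball 0 1 :: 'a set"
  have "emeasure ?M ?B = emeasure lborel ?B"
    by (simp add: emeasure_distr vimage_def f) (simp add: ball_def dist_norm)
  moreover have "emeasure lborel ?B \<noteq> 0" "emeasure lborel ?B \<noteq> \<infinity>"
    using emeasure_lborel_ball_finite[of "0::'a" 1] content_ball_pos[of 1 "0::'a"]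
    by (auto simp: measure_def)
  moreover have "emeasure ?M A * emeasure lborel ?B = emeasure ?M ?B * emeasure lborel A"
    if "A \<in> sets borel" for A
    by (rule translation_invariant_unique[OF sf _ trans that]) auto
  ultimately have "emeasure ?M A = emeasure lborel A" if "A \<in> sets borel" for A
    using that ennreal_mult_cancel_left[of "emeasure lborel ?B" "emeasure ?M A" "emeasure lborel A"]
    by (metis infinity_ennreal_def mult.commute)
  then show ?thesis
    by (intro measure_eqI) auto
qed

lemma lborel_unitary_invariant:
  fixes V :: "'n::finite cmat"
  assumes "unitary_mat V"
  shows "distr lborel borel (\<lambda>X :: 'n cmat. V ** X) = lborel"
proof -
  have "linear (\<lambda>X :: 'n cmat. W ** X)" for W :: "'n cmat"
    by (simp add: bounded_linear.linear matrix_mult.bounded_linear_right)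
  then show ?thesis
    by (intro lborel_linear_isometry_invariant[where g = "\<lambda>X. cadj V ** X"])
      (simp_all add: norm_unitary_mult assms matrix_mul_assoc unitary_matD)
qed

section \<open>Haar probability measures on the unitary group\<close>

definition is_haar :: "'n::finite cmat measure \<Rightarrow> bool" where
  "is_haar \<mu> \<longleftrightarrow> prob_space \<mu> \<and> sets \<mu> = sets borel \<and> emeasure \<mu> {U. unitary_mat U} = 1
      \<and> (\<forall>V. unitary_mat V \<longrightarrow> distr \<mu> borel (\<lambda>U. V ** U) = \<mu>)"

lemma is_haar_AE_unitary:
  assumes "is_haar \<mu>"
  shows "AE U in \<mu>. unitary_mat U"
proof -
  interpret prob_space \<mu> using assms by (simp add: is_haar_def)
  have "{U. unitary_mat U} \<in> sets \<mu>" "prob {U. unitary_mat U} = 1"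
    using assms by (simp_all add: is_haar_def measure_def)
  then show ?thesis
    using AE_in_set_eq_1[of "{U. unitary_mat U}"] by simp
qed

text \<open>The unitary factor, computed by Newton--Schulz iteration, commutes with left
  multiplication by unitaries, so it pushes the uniform measure on a left-invariant
  neighbourhood of the identity forward to a left-invariant measure on the unitary group.\<close>

lemma is_haar_exists: "\<exists>\<mu> :: 'n::finite cmat measure. is_haar \<mu>"
proof -
  \<comment> \<open>The first condition makes the iteration converge, the second makes
    \<open>S\<close> bounded and so of finite measure. Both are stable under left multiplication by
    unitaries.\<close>
  define S :: "'n cmat set" where
    "S = {X. norm (unitary_defect X) < 1/2} \<inter> {X. norm X < norm (mat 1 :: 'n cmat) + 1}"
  define \<nu> where "\<nu> = uniform_measure lborel S"
  define \<mu> where "\<mu> = distr \<nu> borel unitary_part"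
  have "open S"
    unfolding S_def by (intro open_Int open_Collect_less continuous_intros)
  then have S_meas [measurable]: "S \<in> sets borel" by simp
  have "mat 1 \<in> S"
    by (simp add: S_def unitary_defect_def)
  then have pos: "emeasure lborel S \<noteq> 0"
    using open_not_negligible[OF \<open>open S\<close>] null_setsI[of lborel S] S_meas
    by (auto simp: negligible_iff_null_sets dest: null_sets_completionI)
  have fin: "emeasure lborel S \<noteq> \<infinity>"
  proof -
    have "bounded S"
      by (rule bounded_subset[OF bounded_ball[of 0 "norm (mat 1 :: 'n cmat) + 1"]]) (auto simp: S_def)
    then show ?thesis
      using emeasure_bounded_finite[of S] by simp
  qed
  have sets_\<nu> [measurable_cong, simp]: "sets \<nu> = sets borel"
    by (simp add: \<nu>_def)
  have space_\<nu>: "space \<nu> = UNIV"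
    by (simp add: \<nu>_def)
  have AE_S: "AE X in \<nu>. X \<in> S"
    unfolding \<nu>_def by (rule AE_uniform_measureI) auto
  have \<nu>_inv: "distr \<nu> borel (\<lambda>X. V ** X) = \<nu>" if V: "unitary_mat V" for V
  proof (rule measure_eqI)
    fix A assume "A \<in> sets (distr \<nu> borel (\<lambda>X. V ** X))"
    then have A [measurable]: "A \<in> sets borel" by simp
    let ?f = "\<lambda>X :: 'n cmat. V ** X"
    have f [measurable]: "?f \<in> borel_measurable borel"
      by (rule borel_measurable_matrix_mult_left)
    then have fA [measurable]: "?f -` A \<in> sets borel"
      using measurable_sets[OF f A] by (simp only: space_borel Int_UNIV_right)
    have "emeasure (distr \<nu> borel ?f) A = emeasure \<nu> (?f -` A)"
      using emeasure_distr[of ?f \<nu> borel A] f by (simp add: space_\<nu>)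
    also have "\<dots> = emeasure lborel (S \<inter> ?f -` A) / emeasure lborel S"
      unfolding \<nu>_def by (rule emeasure_uniform_measure) simp_all
    also have "S \<inter> ?f -` A = ?f -` (S \<inter> A)"
      by (simp add: S_def set_eq_iff unitary_defect_unitary_mult[OF V] norm_unitary_mult[OF V])
    also have "emeasure lborel (?f -` (S \<inter> A)) = emeasure (distr lborel borel ?f) (S \<inter> A)"
      using emeasure_distr[of ?f lborel borel "S \<inter> A"] f by simp
    also have "\<dots> = emeasure lborel (S \<inter> A)"
      by (simp add: lborel_unitary_invariant[OF V])
    also have "\<dots> / emeasure lborel S = emeasure \<nu> A"
      unfolding \<nu>_def by (rule emeasure_uniform_measure[symmetric]) simp_all
    finally show "emeasure (distr \<nu> borel ?f) A = emeasure \<nu> A" .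
  qed simp
  interpret \<nu>: prob_space \<nu>
    unfolding \<nu>_def by (rule prob_space_uniform_measure) (use pos fin in auto)
  have "prob_space \<mu>"
    unfolding \<mu>_def by (rule \<nu>.prob_space_distr) measurable
  moreover have "emeasure \<mu> {U. unitary_mat U} = 1"
  proof -
    have "AE X in \<nu>. unitary_mat (unitary_part X)"
      using AE_S by eventually_elim (auto simp: S_def intro: unitary_part_unitary)
    then have "AE U in \<mu>. unitary_mat U"
      unfolding \<mu>_def by (subst AE_distr_iff) auto
    then show ?thesis
      using prob_space.emeasure_eq_1_AE[OF \<open>prob_space \<mu>\<close>, of "{U. unitary_mat U}"]
      by (simp add: \<mu>_def)
  qed
  moreover have "distr \<mu> borel (\<lambda>U. V ** U) = \<mu>" if V: "unitary_mat V" for V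
  proof -
    have "distr \<mu> borel (\<lambda>U. V ** U) = distr \<nu> borel (\<lambda>X. V ** unitary_part X)"
      unfolding \<mu>_def by (subst distr_distr) (auto simp: o_def)
    also have "\<dots> = distr \<nu> borel (\<lambda>X. unitary_part (V ** X))"
    proof (rule distr_cong_AE)
      show "AE X in \<nu>. V ** unitary_part X = unitary_part (V ** X)"
        using AE_S by eventually_elim (auto simp: S_def unitary_part_unitary_mult V)
    qed auto
    also have "\<dots> = distr (distr \<nu> borel (\<lambda>X. V ** X)) borel unitary_part"
      by (subst distr_distr) (auto simp: o_def)
    also have "\<dots> = \<mu>"
      by (simp add: \<nu>_inv[OF V] \<mu>_def)
    finally show ?thesis .
  qed
  ultimately have "is_haar \<mu>"
    by (auto simp: is_haar_def \<mu>_def)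
  then show ?thesis ..
qed

text \<open>Take the law of \<open>cadj W ** U\<close> for independent \<open>W\<close> and
  \<open>U\<close>. With \<open>W\<close> fixed, left invariance of \<open>\<nu>\<close> gives
  \<open>\<nu>\<close>; with \<open>U\<close> fixed, the product is the adjoint of
  \<open>cadj U ** W\<close>, and left invariance of \<open>\<mu>\<close> gives the law of
  \<open>cadj W\<close>.\<close>

lemma is_haar_eq_distr_cadj:
  fixes \<mu> \<nu> :: "'n::finite cmat measure"
  assumes \<mu>: "is_haar \<mu>" and \<nu>: "is_haar \<nu>"
  shows "\<nu> = distr \<mu> borel cadj"
proof (rule measure_eqI)
  have sets_\<mu> [measurable_cong]: "sets \<mu> = sets borel" and sets_\<nu> [measurable_cong]: "sets \<nu> = sets borel"
    using \<mu> \<nu> by (auto simp: is_haar_def)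
  then show "sets \<nu> = sets (distr \<mu> borel cadj)" by simp
  fix A assume "A \<in> sets \<nu>"
  then have A [measurable]: "A \<in> sets borel" by (simp add: sets_\<nu>)
  interpret \<mu>: prob_space \<mu> using \<mu> by (simp add: is_haar_def)
  interpret \<nu>: prob_space \<nu> using \<nu> by (simp add: is_haar_def)
  interpret pair_sigma_finite \<mu> \<nu> ..
  have inv: "(\<integral>\<^sup>+U. f (V ** U) \<partial>M) = (\<integral>\<^sup>+U. f U \<partial>M)"
    if "is_haar M" "unitary_mat V" "f \<in> borel_measurable borel" for M V and f :: "'n cmat \<Rightarrow> ennreal"
  proof -
    have sets_M [measurable_cong]: "sets M = sets borel" using that by (auto simp: is_haar_def)
    have "(\<integral>\<^sup>+U. f U \<partial>M) = (\<integral>\<^sup>+U. f U \<partial>distr M borel (\<lambda>U. V ** U))"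
      using that by (auto simp: is_haar_def)
    then show ?thesis
      using that by (subst (asm) nn_integral_distr) auto
  qed
  have "emeasure \<nu> A = (\<integral>\<^sup>+W. \<integral>\<^sup>+U. indicator A (cadj W ** U) \<partial>\<nu> \<partial>\<mu>)"
  proof -
    have "AE W in \<mu>. (\<integral>\<^sup>+U. indicator A (cadj W ** U) \<partial>\<nu>) = emeasure \<nu> A"
      using is_haar_AE_unitary[OF \<mu>]
      by eventually_elim (simp add: inv[OF \<nu>, of _ "indicator A"] unitary_mat_cadj sets_\<nu>)
    then have "(\<integral>\<^sup>+W. \<integral>\<^sup>+U. indicator A (cadj W ** U) \<partial>\<nu> \<partial>\<mu>) = (\<integral>\<^sup>+W. emeasure \<nu> A \<partial>\<mu>)"
      by (rule nn_integral_cong_AE)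
    then show ?thesis by (simp add: \<mu>.emeasure_space_1)
  qed
  also have "\<dots> = (\<integral>\<^sup>+U. \<integral>\<^sup>+W. indicator A (cadj W ** U) \<partial>\<mu> \<partial>\<nu>)"
    by (rule Fubini'[symmetric]) measurable
  also have "\<dots> = (\<integral>\<^sup>+U. emeasure (distr \<mu> borel cadj) A \<partial>\<nu>)"
  proof (rule nn_integral_cong_AE)
    show "AE U in \<nu>. (\<integral>\<^sup>+W. indicator A (cadj W ** U) \<partial>\<mu>) = emeasure (distr \<mu> borel cadj) A"
      using is_haar_AE_unitary[OF \<nu>]
    proof eventually_elim
      case (elim U)
      have "(\<integral>\<^sup>+W. indicator A (cadj W ** U) \<partial>\<mu>) = (\<integral>\<^sup>+W. indicator A (cadj (cadj U ** W)) \<partial>\<mu>)"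
        by (simp add: cadj_matrix_mult)
      also have "\<dots> = (\<integral>\<^sup>+W. indicator A (cadj W) \<partial>\<mu>)"
        using inv[OF \<mu> unitary_mat_cadj[OF elim], of "\<lambda>W. indicator A (cadj W)"] by simp
      also have "\<dots> = (\<integral>\<^sup>+W. indicator A W \<partial>distr \<mu> borel cadj)"
        by (rule nn_integral_distr[symmetric]) auto
      also have "\<dots> = emeasure (distr \<mu> borel cadj) A" by simp
      finally show ?case .
    qed
  qed
  also have "\<dots> = emeasure (distr \<mu> borel cadj) A"
    by (simp add: \<nu>.emeasure_space_1)
  finally show "emeasure \<nu> A = emeasure (distr \<mu> borel cadj) A" .
qed

text \<open>Two Haar measures are both the adjoint image of the first one, hence equal. With
  existence, this shows that the \<open>THE\<close> in \<open>haar_unitary\<close> denotes a Haar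
  measure.\<close>

lemma is_haar_haar_unitary: "is_haar (haar_unitary :: 'n::finite cmat measure)"
proof -
  have "\<exists>!\<mu> :: 'n cmat measure. is_haar \<mu>"
  proof (rule ex_ex1I[OF is_haar_exists])
    fix \<mu> \<nu> :: "'n cmat measure"
    assume "is_haar \<mu>" "is_haar \<nu>"
    then show "\<mu> = \<nu>"
      using is_haar_eq_distr_cadj[of \<mu> \<mu>] is_haar_eq_distr_cadj[of \<mu> \<nu>] by simp
  qed
  then show ?thesis
    unfolding haar_unitary_def is_haar_def[symmetric] by (rule theI')
qed

section \<open>Infinitesimal invariance of averaged tensors\<close>

lemma prob_space_haar_unitary: "prob_space haar_unitary"
  and sets_haar_unitary [measurable_cong, simp]: "sets haar_unitary = sets borel"
  using is_haar_haar_unitary by (auto simp: is_haar_def)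

lemma space_haar_unitary [simp]: "space haar_unitary = UNIV"
  using sets_eq_imp_space_eq[OF sets_haar_unitary] by simp

lemma AE_haar_unitary: "AE U in haar_unitary. unitary_mat U"
  by (rule is_haar_AE_unitary[OF is_haar_haar_unitary])

lemma integral_haar_left_invariant:
  fixes f :: "'n::finite cmat \<Rightarrow> complex"
  assumes "unitary_mat V" "f \<in> borel_measurable borel"
  shows "(\<integral>U. f (V ** U) \<partial>haar_unitary) = (\<integral>U. f U \<partial>haar_unitary)"
proof -
  have "(\<integral>U. f U \<partial>haar_unitary) = (\<integral>U. f U \<partial>distr haar_unitary borel (\<lambda>U. V ** U))"
    using is_haar_haar_unitary[where 'n = 'n] assms(1) by (simp add: is_haar_def)
  also have "\<dots> = (\<integral>U. f (V ** U) \<partial>haar_unitary)"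
    by (rule integral_distr) (use assms in measurable)
  finally show ?thesis by simp
qed

text \<open>Such a function may be unbounded on all matrices, but the Haar measure is concentrated
  on the compact unitary group.\<close>

lemma integrable_haar_continuous:
  fixes f :: "'n::finite cmat \<Rightarrow> complex"
  assumes "continuous_on UNIV f"
  shows "integrable haar_unitary f"
proof -
  interpret prob_space "haar_unitary :: 'n cmat measure" by (rule prob_space_haar_unitary)
  have "bounded (f ` {U. unitary_mat U})"
    by (intro compact_imp_bounded compact_continuous_image compact_unitary
        continuous_on_subset[OF assms]) auto
  then obtain K where "\<And>U. unitary_mat U \<Longrightarrow> norm (f U) \<le> K"
    by (auto simp: bounded_iff)
  then show ?thesis
    using AE_haar_unitary borel_measurable_continuous_onI[OF assms]
    by (intro integrable_const_bound[of _ K]) auto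
qed

text \<open>A general index set is allowed so that the positions filled from \<open>A\<close> and
  those filled from \<open>B\<close> can be treated separately.\<close>

definition conj_tensor ::
  "nat set \<Rightarrow> (nat \<Rightarrow> 'n::finite cmat) \<Rightarrow> (nat \<Rightarrow> 'n) \<Rightarrow> (nat \<Rightarrow> 'n) \<Rightarrow> complex" where
  "conj_tensor I M i j = (\<integral>U. (\<Prod>k\<in>I. (U ** M k ** cadj U) $ i k $ j k) \<partial>haar_unitary)"

lemma conj_tensor_cong:
  "(\<And>k. k \<in> I \<Longrightarrow> i k = i' k) \<Longrightarrow> (\<And>k. k \<in> I \<Longrightarrow> j k = j' k) \<Longrightarrow> conj_tensor I M i j = conj_tensor I M i' j'"
  by (simp add: conj_tensor_def cong: prod.cong)

lemma cnj_of_bool [simp]: "cnj (of_bool b) = of_bool b"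
  by (cases b) auto

definition commutator_entry :: "('n::finite \<Rightarrow> 'n \<Rightarrow> complex) \<Rightarrow> 'n cmat \<Rightarrow> 'n \<Rightarrow> 'n \<Rightarrow> complex" where
  "commutator_entry X W a b = (\<Sum>c\<in>UNIV. X a c * W $ c $ b) - (\<Sum>d\<in>UNIV. W $ a $ d * X d b)"

text \<open>The derivative at \<open>\<theta> = 0\<close> of the entry product for the matrices \<open>exp(\<theta>X) U M\<^sub>k U\<^sup>* exp(-\<theta>X)\<close>.\<close>

definition conj_derivation ::
  "nat set \<Rightarrow> (nat \<Rightarrow> 'n::finite cmat) \<Rightarrow> (nat \<Rightarrow> 'n) \<Rightarrow> (nat \<Rightarrow> 'n) \<Rightarrow>
    ('n \<Rightarrow> 'n \<Rightarrow> complex) \<Rightarrow> 'n cmat \<Rightarrow> complex" where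
  "conj_derivation I M i j X U =
    (\<Sum>k\<in>I. commutator_entry X (U ** M k ** cadj U) (i k) (j k) *
      (\<Prod>l\<in>I - {k}. (U ** M l ** cadj U) $ i l $ j l))"

lemma integrable_conj_derivation: "integrable haar_unitary (conj_derivation I M i j X)"
  unfolding conj_derivation_def[abs_def] commutator_entry_def
  by (intro integrable_haar_continuous continuous_intros)

text \<open>Left invariance makes the averaged product constant along a curve
  \<open>V \<theta>\<close> of unitaries with tangent \<open>\<i>\<close> times
  \<open>v a * cnj (v b)\<close> at 0, so its derivative at 0 vanishes. Expanding the product into
  finitely many terms separates \<open>\<theta>\<close> from \<open>U\<close>, so no differentiation
  under the integral occurs.\<close>

lemma integral_conj_derivation_rank_one:
  fixes v :: "'n::finite \<Rightarrow> complex" and M :: "nat \<Rightarrow> 'n cmat"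
  assumes I: "finite I"
  shows "(\<integral>U. conj_derivation I M i j (\<lambda>a b. v a * cnj (v b)) U \<partial>haar_unitary) = 0"
proof -
  define t :: complex where "t = (\<Sum>c\<in>UNIV. v c * cnj (v c))"
  \<comment> \<open>With P the rank-one matrix of \<open>v\<close>, so that P^2 = tP, the matrix 1 +
    zP is the Cayley transform (1 + i\<theta>P/2)(1 - i\<theta>P/2)^(-1).\<close>
  define z :: "real \<Rightarrow> complex" where "z \<theta> = \<i> * of_real \<theta> / (1 - \<i> * of_real \<theta> * t / 2)" for \<theta>
  define V :: "real \<Rightarrow> 'n cmat" where
    "V \<theta> = (\<chi> a b. of_bool (a = b) + z \<theta> * (v a * cnj (v b)))" for \<theta>
  \<comment> \<open>\<open>p k cd\<close> is the coefficient of the entry \<open>cd\<close> of a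
    matrix in entry \<open>(i k, j k)\<close> of its conjugate by \<open>V \<theta>\<close>;
    \<open>dp\<close> is the derivative of this coefficient at 0.\<close>
  define p where "p k cd \<theta> = V \<theta> $ i k $ fst cd * cnj (V \<theta> $ j k $ snd cd)" for k cd \<theta>
  define dp where "dp k cd = \<i> * (v (i k) * cnj (v (fst cd))) * of_bool (j k = snd cd)
      - of_bool (i k = fst cd) * \<i> * (cnj (v (j k)) * v (snd cd))" for k cd
  define W where "W k U = U ** M k ** cadj U" for k and U :: "'n cmat"
  define w where "w k U cd = W k U $ fst cd $ snd cd" for k U and cd :: "'n \<times> 'n"
  \<comment> \<open>Choice functions picking one entry per factor when the product of sums is
    multiplied out.\<close>
  define G where "G = Pi\<^sub>E I (\<lambda>_. UNIV :: ('n \<times> 'n) set)"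
  define D where "D g = (\<Sum>k\<in>I. dp k (g k) * (\<Prod>l\<in>I - {k}. p l (g l) 0))" for g
  have t_real: "cnj t = t"
    by (simp add: t_def mult.commute)
  have z0: "z 0 = 0" by (simp add: z_def)
  \<comment> \<open>This is the condition for 1 + zP to be unitary, again because P^2 = tP.\<close>
  have z_rel: "z \<theta> + cnj (z \<theta>) + z \<theta> * cnj (z \<theta>) * t = 0" for \<theta>
  proof -
    have "Im t = 0" using t_real by (simp add: complex_eq_iff)
    then have t: "t = of_real (Re t)" by (simp add: complex_eq_iff)
    have "Re (1 - \<i> * of_real \<theta> * t / 2) = 1" by (subst t) simp
    then have n1: "1 - \<i> * of_real \<theta> * t / 2 \<noteq> 0" by fastforce
    have "Re (1 + \<i> * of_real \<theta> * t / 2) = 1" by (subst t) simp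
    then have n2: "1 + \<i> * of_real \<theta> * t / 2 \<noteq> 0" by fastforce
    have c: "cnj (z \<theta>) = - (\<i> * of_real \<theta>) / (1 + \<i> * of_real \<theta> * t / 2)"
      by (simp add: z_def t_real)
    show ?thesis
      unfolding c unfolding z_def using n1 n2
      by (simp add: divide_simps) (simp add: algebra_simps)
  qed
  have V_unitary: "unitary_mat (V \<theta>)" for \<theta>
  proof -
    have "(V \<theta> ** cadj (V \<theta>)) $ a $ b = mat 1 $ a $ b" for a b
    proof -
      have "(V \<theta> ** cadj (V \<theta>)) $ a $ b =
          (\<Sum>c\<in>UNIV. (of_bool (a = c) + z \<theta> * (v a * cnj (v c))) *
            (of_bool (b = c) + cnj (z \<theta>) * (cnj (v b) * v c)))"
        by (simp add: matrix_matrix_mult_def cadj_def V_def)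
      also have "\<dots> = (\<Sum>c\<in>UNIV. of_bool (a = c) * of_bool (b = c))
          + (\<Sum>c\<in>UNIV. of_bool (a = c) * (cnj (z \<theta>) * (cnj (v b) * v c)))
          + (\<Sum>c\<in>UNIV. of_bool (b = c) * (z \<theta> * (v a * cnj (v c))))
          + (\<Sum>c\<in>UNIV. (z \<theta> * cnj (z \<theta>) * v a * cnj (v b)) * (v c * cnj (v c)))"
        by (simp add: algebra_simps sum.distrib)
      also have "\<dots> = of_bool (a = b) + cnj (z \<theta>) * (cnj (v b) * v a) + z \<theta> * (v a * cnj (v b))
          + z \<theta> * cnj (z \<theta>) * v a * cnj (v b) * t"
        by (simp add: t_def sum_distrib_left of_bool_def if_distrib[of "\<lambda>x. x * _"] sum.delta sum.delta' cong: if_cong)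
      also have "\<dots> = of_bool (a = b) + (z \<theta> + cnj (z \<theta>) + z \<theta> * cnj (z \<theta>) * t) * (v a * cnj (v b))"
        by (simp add: algebra_simps)
      finally show ?thesis by (simp add: z_rel mat_def)
    qed
    then show ?thesis by (simp add: unitary_mat_def vec_eq_iff)
  qed
  have z_deriv: "(z has_derivative (\<lambda>h. of_real h * \<i>)) (at 0)"
    unfolding z_def[abs_def]
    by (auto intro!: derivative_eq_intros simp: fun_eq_iff)
  have V_deriv: "((\<lambda>\<theta>. V \<theta> $ a $ b) has_derivative (\<lambda>h. of_real h * (\<i> * (v a * cnj (v b))))) (at 0)" for a b
    unfolding V_def by (auto intro!: derivative_eq_intros z_deriv simp: fun_eq_iff)
  have V0: "V 0 $ a $ b = of_bool (a = b)" for a b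
    by (simp add: V_def z0)
  have p_deriv: "(p k cd has_derivative (\<lambda>h. of_real h * dp k cd)) (at 0)" for k cd
    unfolding p_def[abs_def]
    by (rule has_derivative_eq_rhs[OF has_derivative_mult[OF V_deriv
          bounded_linear.has_derivative[OF bounded_linear_cnj V_deriv]]])
      (auto simp: fun_eq_iff V0 dp_def algebra_simps)
  have entry: "(V \<theta> ** X ** cadj (V \<theta>)) $ i k $ j k = (\<Sum>cd\<in>UNIV. p k cd \<theta> * X $ fst cd $ snd cd)"
    for \<theta> k X
  proof -
    have "(V \<theta> ** X ** cadj (V \<theta>)) $ i k $ j k = (\<Sum>d\<in>UNIV. \<Sum>c\<in>UNIV. p k (c, d) \<theta> * X $ c $ d)"
      by (simp add: matrix_matrix_mult_def cadj_def p_def sum_distrib_left sum_distrib_right mult_ac)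
    also have "\<dots> = (\<Sum>c\<in>UNIV. \<Sum>d\<in>UNIV. p k (c, d) \<theta> * X $ c $ d)"
      by (rule sum.swap)
    also have "\<dots> = (\<Sum>cd\<in>UNIV. p k cd \<theta> * X $ fst cd $ snd cd)"
      by (simp add: UNIV_Times_UNIV[symmetric] sum.cartesian_product' del: UNIV_Times_UNIV)
    finally show ?thesis .
  qed
  have expand: "(\<Prod>k\<in>I. \<Sum>cd\<in>UNIV. p k cd \<theta> * w k U cd) = (\<Sum>g\<in>G. (\<Prod>k\<in>I. p k (g k) \<theta>) * (\<Prod>k\<in>I. w k U (g k)))"
    for \<theta> U
    unfolding G_def using I by (simp add: prod_sum_PiE prod.distrib)
  have prod_deriv: "((\<lambda>\<theta>. \<Prod>k\<in>I. p k (g k) \<theta>) has_derivative (\<lambda>h. of_real h * D g)) (at 0)" for g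
    by (rule has_derivative_eq_rhs[OF has_derivative_prod[OF p_deriv]])
      (simp add: fun_eq_iff D_def sum_distrib_left mult_ac)
  have int_w: "integrable haar_unitary (\<lambda>U. \<Prod>k\<in>I. w k U (g k))" for g
    unfolding w_def W_def by (intro integrable_haar_continuous continuous_intros)
  have const: "(\<Sum>g\<in>G. (\<Prod>k\<in>I. p k (g k) \<theta>) * (\<integral>U. (\<Prod>k\<in>I. w k U (g k)) \<partial>haar_unitary)) = conj_tensor I M i j"
    for \<theta>
  proof -
    have "conj_tensor I M i j = (\<integral>U. (\<Prod>k\<in>I. ((V \<theta> ** U) ** M k ** cadj (V \<theta> ** U)) $ i k $ j k) \<partial>haar_unitary)"
      unfolding conj_tensor_def
      by (rule integral_haar_left_invariant[symmetric, OF V_unitary])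
        (intro borel_measurable_continuous_onI continuous_intros)
    also have "\<dots> = (\<integral>U. (\<Prod>k\<in>I. (V \<theta> ** W k U ** cadj (V \<theta>)) $ i k $ j k) \<partial>haar_unitary)"
      by (simp add: W_def cadj_matrix_mult matrix_mul_assoc)
    also have "\<dots> = (\<integral>U. (\<Sum>g\<in>G. (\<Prod>k\<in>I. p k (g k) \<theta>) * (\<Prod>k\<in>I. w k U (g k))) \<partial>haar_unitary)"
      unfolding entry expand[symmetric] by (simp add: w_def)
    also have "\<dots> = (\<Sum>g\<in>G. (\<Prod>k\<in>I. p k (g k) \<theta>) * (\<integral>U. (\<Prod>k\<in>I. w k U (g k)) \<partial>haar_unitary))"
      by (subst Bochner_Integration.integral_sum) (auto intro!: integrable_mult_right int_w)
    finally show ?thesis by simp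
  qed
  have "((\<lambda>\<theta>. \<Sum>g\<in>G. (\<Prod>k\<in>I. p k (g k) \<theta>) * (\<integral>U. (\<Prod>k\<in>I. w k U (g k)) \<partial>haar_unitary)) has_derivative
      (\<lambda>h. \<Sum>g\<in>G. (of_real h * D g) * (\<integral>U. (\<Prod>k\<in>I. w k U (g k)) \<partial>haar_unitary))) (at 0)"
    by (intro has_derivative_sum has_derivative_mult_left prod_deriv)
  then have "((\<lambda>\<theta>::real. conj_tensor I M i j) has_derivative
      (\<lambda>h. \<Sum>g\<in>G. (of_real h * D g) * (\<integral>U. (\<Prod>k\<in>I. w k U (g k)) \<partial>haar_unitary))) (at 0)"
    by (simp only: const)
  then have "(\<lambda>h::real. \<Sum>g\<in>G. (of_real h * D g) * (\<integral>U. (\<Prod>k\<in>I. w k U (g k)) \<partial>haar_unitary)) = (\<lambda>h. 0)"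
    by (rule has_derivative_unique) (rule has_derivative_const)
  from fun_cong[OF this, of 1]
  have zero: "(\<Sum>g\<in>G. D g * (\<integral>U. (\<Prod>k\<in>I. w k U (g k)) \<partial>haar_unitary)) = 0"
    by simp
  \<comment> \<open>For fixed \<open>U\<close> the same product is differentiated twice, once by the
    product rule (\<open>d1\<close>) and once after expansion (\<open>d2\<close>); uniqueness of
    derivatives identifies the results.\<close>
  have pointwise: "\<i> * conj_derivation I M i j (\<lambda>a b. v a * cnj (v b)) U
      = (\<Sum>g\<in>G. D g * (\<Prod>k\<in>I. w k U (g k)))" for U
  proof -
    let ?dE = "\<lambda>k. \<Sum>cd\<in>UNIV. dp k cd * w k U cd"
    have E0: "(\<Sum>cd\<in>UNIV. p k cd 0 * w k U cd) = W k U $ i k $ j k" for k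
    proof -
      have "V 0 = mat 1" by (simp add: vec_eq_iff V0 mat_def)
      then show ?thesis
        using entry[of 0 "W k U" k] by (simp add: w_def)
    qed
    have dE: "?dE k = \<i> * commutator_entry (\<lambda>a b. v a * cnj (v b)) (W k U) (i k) (j k)" for k
    proof -
      have "?dE k = (\<Sum>c\<in>UNIV. \<Sum>d\<in>UNIV. \<i> * (v (i k) * cnj (v c)) * W k U $ c $ d * of_bool (j k = d))
          - (\<Sum>c\<in>UNIV. \<Sum>d\<in>UNIV. of_bool (i k = c) * (\<i> * (cnj (v (j k)) * v d) * W k U $ c $ d))"
        by (simp add: UNIV_Times_UNIV[symmetric] sum.cartesian_product' dp_def w_def
            sum_subtractf algebra_simps del: UNIV_Times_UNIV)
      also have "(\<Sum>c\<in>UNIV. \<Sum>d\<in>UNIV. \<i> * (v (i k) * cnj (v c)) * W k U $ c $ d * of_bool (j k = d))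
          = (\<Sum>c\<in>UNIV. \<i> * (v (i k) * cnj (v c)) * W k U $ c $ j k)"
        by (simp add: of_bool_def if_distrib[of "\<lambda>x. _ * x"] sum.delta' cong: if_cong)
      also have "(\<Sum>c\<in>UNIV. \<Sum>d\<in>UNIV. of_bool (i k = c) * (\<i> * (cnj (v (j k)) * v d) * W k U $ c $ d))
          = (\<Sum>d\<in>UNIV. \<i> * (cnj (v (j k)) * v d) * W k U $ i k $ d)"
        by (subst sum.swap) (simp add: of_bool_def if_distrib[of "\<lambda>x. x * _"] sum.delta' cong: if_cong)
      finally show ?thesis
        by (simp add: commutator_entry_def right_diff_distrib sum_distrib_left mult_ac)
    qed
    have d1: "((\<lambda>\<theta>. \<Prod>k\<in>I. \<Sum>cd\<in>UNIV. p k cd \<theta> * w k U cd) has_derivative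
        (\<lambda>h. \<Sum>k\<in>I. (\<Sum>cd\<in>UNIV. of_real h * dp k cd * w k U cd) *
          (\<Prod>l\<in>I - {k}. \<Sum>cd\<in>UNIV. p l cd 0 * w l U cd))) (at 0)"
      by (intro has_derivative_prod has_derivative_sum has_derivative_mult_left p_deriv)
    have d2: "((\<lambda>\<theta>. \<Prod>k\<in>I. \<Sum>cd\<in>UNIV. p k cd \<theta> * w k U cd) has_derivative
        (\<lambda>h. \<Sum>g\<in>G. (of_real h * D g) * (\<Prod>k\<in>I. w k U (g k)))) (at 0)"
      unfolding expand by (intro has_derivative_sum has_derivative_mult_left prod_deriv)
    have "(\<Sum>k\<in>I. ?dE k * (\<Prod>l\<in>I - {k}. W l U $ i l $ j l)) = (\<Sum>g\<in>G. D g * (\<Prod>k\<in>I. w k U (g k)))"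
      using fun_cong[OF has_derivative_unique[OF d1 d2], of 1] by (simp add: E0)
    then show ?thesis
      by (simp add: dE conj_derivation_def W_def[symmetric] sum_distrib_left mult_ac)
  qed
  have "\<i> * (\<integral>U. conj_derivation I M i j (\<lambda>a b. v a * cnj (v b)) U \<partial>haar_unitary)
      = (\<integral>U. (\<Sum>g\<in>G. D g * (\<Prod>k\<in>I. w k U (g k))) \<partial>haar_unitary)"
    by (simp flip: pointwise)
  also have "\<dots> = (\<Sum>g\<in>G. D g * (\<integral>U. (\<Prod>k\<in>I. w k U (g k)) \<partial>haar_unitary))"
    by (subst Bochner_Integration.integral_sum) (auto intro!: integrable_mult_right int_w)
  finally show ?thesis by (simp add: zero)
qed

section \<open>Expansion of invariant tensors in permutations\<close>

text \<open>Invariance of a tensor under the matrix unit \<open>E\<^sub>a\<^sub>b\<close> of the Lie algebra of the general linear group,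
  acting as a derivation on the tensor power with factors indexed by \<open>I\<close>.\<close>

definition gl_invariant :: "nat set \<Rightarrow> ((nat \<Rightarrow> 'n) \<Rightarrow> (nat \<Rightarrow> 'n) \<Rightarrow> complex) \<Rightarrow> bool" where
  "gl_invariant I T \<longleftrightarrow> (\<forall>i j a b.
    (\<Sum>k\<in>I. of_bool (i k = a) * T (i(k := b)) j) = (\<Sum>k\<in>I. of_bool (j k = b) * T i (j(k := a))))"

text \<open>Multi-indices are total functions; this says that only their values on \<open>I\<close>
  matter, not that the tensor vanishes elsewhere.\<close>

definition supported_on :: "nat set \<Rightarrow> ((nat \<Rightarrow> 'n) \<Rightarrow> (nat \<Rightarrow> 'n) \<Rightarrow> complex) \<Rightarrow> bool" where
  "supported_on I T \<longleftrightarrow> (\<forall>i i' j j'. (\<forall>k\<in>I. i k = i' k) \<longrightarrow> (\<forall>k\<in>I. j k = j' k) \<longrightarrow> T i j = T i' j')"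

lemma gl_invariantD:
  "gl_invariant I T \<Longrightarrow>
    (\<Sum>k\<in>I. of_bool (i k = a) * T (i(k := b)) j) = (\<Sum>k\<in>I. of_bool (j k = b) * T i (j(k := a)))"
  by (auto simp: gl_invariant_def)

lemma supported_onD:
  "supported_on I T \<Longrightarrow> (\<And>k. k \<in> I \<Longrightarrow> i k = i' k) \<Longrightarrow> (\<And>k. k \<in> I \<Longrightarrow> j k = j' k) \<Longrightarrow> T i j = T i' j'"
  unfolding supported_on_def by blast

lemma supported_on_conj_tensor: "supported_on I (conj_tensor I M)"
  unfolding supported_on_def by (auto intro!: conj_tensor_cong)

text \<open>The polarization identity: in the weighted sum over the four powers of
  \<open>\<i>\<close>, only the cross term of \<open>a\<close> with \<open>b\<close>
  survives.\<close>

lemma matrix_unit_polarization: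
  fixes a b c d :: 'n
  defines "v \<equiv> \<lambda>s x. of_bool (x = a) + \<i> ^ s * of_bool (x = b) :: complex"
  shows "of_bool (c = a \<and> d = b) = (\<Sum>s<4::nat. \<i> ^ s / 4 * (v s c * cnj (v s d)))"
  by (auto simp: v_def numeral_eq_Suc field_simps)

lemma conj_derivation_lincomb:
  "conj_derivation I M i j (\<lambda>c d. \<Sum>s\<in>S. \<alpha> s * X s c d) U = (\<Sum>s\<in>S. \<alpha> s * conj_derivation I M i j (X s) U)"
proof -
  have "commutator_entry (\<lambda>c d. \<Sum>s\<in>S. \<alpha> s * X s c d) W a b = (\<Sum>s\<in>S. \<alpha> s * commutator_entry (X s) W a b)" for W a b
  proof -
    have "(\<Sum>c\<in>UNIV. (\<Sum>s\<in>S. \<alpha> s * X s a c) * W $ c $ b) = (\<Sum>s\<in>S. \<Sum>c\<in>UNIV. \<alpha> s * (X s a c * W $ c $ b))"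
      by (subst sum.swap) (simp add: sum_distrib_left sum_distrib_right mult_ac)
    moreover have "(\<Sum>d\<in>UNIV. W $ a $ d * (\<Sum>s\<in>S. \<alpha> s * X s d b)) = (\<Sum>s\<in>S. \<Sum>d\<in>UNIV. \<alpha> s * (W $ a $ d * X s d b))"
      by (subst sum.swap) (simp add: sum_distrib_left mult_ac)
    ultimately show ?thesis
      by (simp add: commutator_entry_def right_diff_distrib sum_subtractf sum_distrib_left)
  qed
  then show ?thesis
    unfolding conj_derivation_def
    by (simp add: sum_distrib_right sum_distrib_left mult.assoc) (rule sum.swap)
qed

text \<open>The derivation is complex linear in its generator, so polarization carries the vanishing
  from Hermitian rank-one matrices to all matrix units. This is the complexification step.\<close>

lemma integral_conj_derivation_matrix_unit:
  fixes M :: "nat \<Rightarrow> 'n::finite cmat"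
  assumes "finite I"
  shows "(\<integral>U. conj_derivation I M i j (\<lambda>c d. of_bool (c = a \<and> d = b)) U \<partial>haar_unitary) = 0"
proof -
  define v where "v s x = (of_bool (x = a) + \<i> ^ s * of_bool (x = b) :: complex)" for s :: nat and x
  have "conj_derivation I M i j (\<lambda>c d. of_bool (c = a \<and> d = b)) U
      = (\<Sum>s<4. \<i> ^ s / 4 * conj_derivation I M i j (\<lambda>c d. v s c * cnj (v s d)) U)" for U
    unfolding matrix_unit_polarization[of _ a _ b, folded v_def] by (rule conj_derivation_lincomb)
  then show ?thesis
    by (simp add: Bochner_Integration.integral_sum integrable_mult_right integrable_conj_derivation
        integral_conj_derivation_rank_one[OF assms])
qed

text \<open>The commutator with a matrix unit turns row index \<open>a\<close> into \<open>b\<close>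
  and, with a minus sign, column index \<open>b\<close> into \<open>a\<close>. Integrating the
  derivation term by term gives the two sides of the invariance relation.\<close>

lemma gl_invariant_conj_tensor:
  fixes M :: "nat \<Rightarrow> 'n::finite cmat"
  assumes I: "finite I"
  shows "gl_invariant I (conj_tensor I M)"
  unfolding gl_invariant_def
proof (intro allI)
  fix i j :: "nat \<Rightarrow> 'n" and a b :: 'n
  define W where "W k U = U ** M k ** cadj U" for k and U :: "'n cmat"
  let ?F = "\<lambda>i j U. \<Prod>l\<in>I. W l U $ i l $ j l"
  have int: "integrable haar_unitary (?F i j)" for i j
    unfolding W_def by (intro integrable_haar_continuous continuous_intros)
  have T: "conj_tensor I M i j = (\<integral>U. ?F i j U \<partial>haar_unitary)" for i j
    by (simp add: conj_tensor_def W_def)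
  have comm: "commutator_entry (\<lambda>c d. of_bool (c = a \<and> d = b)) X p q
      = of_bool (p = a) * X $ b $ q - of_bool (q = b) * X $ p $ a" for X p q
    by (auto simp: commutator_entry_def of_bool_def if_distrib[of "\<lambda>x. x * _"] if_distrib[of "\<lambda>x. _ * x"]
        sum.delta sum.delta' cong: if_cong)
  have "conj_derivation I M i j (\<lambda>c d. of_bool (c = a \<and> d = b)) U
      = (\<Sum>k\<in>I. of_bool (i k = a) * ?F (i(k := b)) j U) - (\<Sum>k\<in>I. of_bool (j k = b) * ?F i (j(k := a)) U)" for U
    unfolding conj_derivation_def sum_subtractf[symmetric]
  proof (rule sum.cong)
    fix k assume k: "k \<in> I"
    have "?F (i(k := b)) j U = W k U $ b $ j k * (\<Prod>l\<in>I - {k}. W l U $ i l $ j l)"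
      using I k by (subst prod.remove[of I k]) (auto intro!: prod.cong)
    moreover have "?F i (j(k := a)) U = W k U $ i k $ a * (\<Prod>l\<in>I - {k}. W l U $ i l $ j l)"
      using I k by (subst prod.remove[of I k]) (auto intro!: prod.cong)
    ultimately show "commutator_entry (\<lambda>c d. of_bool (c = a \<and> d = b)) (U ** M k ** cadj U) (i k) (j k) *
        (\<Prod>l\<in>I - {k}. (U ** M l ** cadj U) $ i l $ j l)
      = of_bool (i k = a) * ?F (i(k := b)) j U - of_bool (j k = b) * ?F i (j(k := a)) U"
      by (simp add: comm W_def[symmetric] left_diff_distrib)
  qed simp
  then have "(\<integral>U. conj_derivation I M i j (\<lambda>c d. of_bool (c = a \<and> d = b)) U \<partial>haar_unitary)
      = (\<Sum>k\<in>I. of_bool (i k = a) * conj_tensor I M (i(k := b)) j)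
        - (\<Sum>k\<in>I. of_bool (j k = b) * conj_tensor I M i (j(k := a)))"
    unfolding T
    by (simp add: Bochner_Integration.integral_diff Bochner_Integration.integral_sum int
        integrable_mult_right Bochner_Integration.integrable_sum)
  then show "(\<Sum>k\<in>I. of_bool (i k = a) * conj_tensor I M (i(k := b)) j)
      = (\<Sum>k\<in>I. of_bool (j k = b) * conj_tensor I M i (j(k := a)))"
    by (simp add: integral_conj_derivation_matrix_unit[OF I])
qed

text \<open>For the diagonal matrix unit at \<open>a\<close> every replacement is trivial, so
  invariance says that the difference of the two cardinalities times \<open>T i j\<close> is
  zero.\<close>

lemma gl_invariant_weight:
  assumes "gl_invariant I T" "finite I" "card {k \<in> I. i k = a} \<noteq> card {k \<in> I. j k = a}"
  shows "T i j = 0"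
proof -
  have upd: "of_bool (f k = a) * g (f(k := a)) = of_bool (f k = a) * g f"
    for f :: "nat \<Rightarrow> 'a" and g :: "_ \<Rightarrow> complex" and k
    by (auto simp: fun_upd_idem)
  have "(\<Sum>k\<in>I. of_bool (i k = a) * T i j) = (\<Sum>k\<in>I. of_bool (j k = a) * T i j)"
    using gl_invariantD[OF assms(1), of i a a j]
    by (simp add: upd[of i _ "\<lambda>i. T i j"] upd[of j _ "T i"])
  then have "of_nat (card {k \<in> I. i k = a}) * T i j = of_nat (card {k \<in> I. j k = a}) * T i j"
    using assms(2) by (simp add: sum_distrib_right[symmetric] sum_of_bool_eq Int_def)
  then show ?thesis
    using assms(3) by simp
qed

text \<open>Changing \<open>j\<close> at one wrong position \<open>p\<close> to \<open>j\<^sub>0 p\<close> and applying the matrix unit that undoes this change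
  gives \<open>j\<close> back up to terms that are again closer to \<open>j\<^sub>0\<close>.\<close>

lemma gl_invariant_eq_0:
  assumes T: "gl_invariant I T" "supported_on I T" and I: "finite I" and inj: "inj_on j0 I"
    and zero: "\<And>i. T i j0 = 0"
  shows "T i j = 0"
proof (induction "card {k \<in> I. j k \<noteq> j0 k}" arbitrary: i j rule: less_induct)
  case less
  show ?case
  proof (cases "\<exists>p\<in>I. j p \<noteq> j0 p")
    case False
    then have "T i j = T i j0"
      by (intro supported_onD[OF T(2)]) auto
    then show ?thesis using zero by simp
  next
    case True
    then obtain p where p: "p \<in> I" "j p \<noteq> j0 p" by blast
    define j' where "j' = j(p := j0 p)"
    have closer: "T i f = 0" if "{k \<in> I. f k \<noteq> j0 k} \<subset> {k \<in> I. j k \<noteq> j0 k}" for i f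
      by (rule less.hyps) (use that I in \<open>auto intro: psubset_card_mono\<close>)
    have "T i j' = 0" for i
      by (rule closer) (use p in \<open>auto simp: j'_def split: if_splits\<close>)
    \<comment> \<open>The other side of the invariance relation only involves column
      \<open>j'\<close>, where \<open>T\<close> already vanishes for every row.\<close>
    then have "0 = (\<Sum>k\<in>I. of_bool (j' k = j0 p) * T i (j'(k := j p)))"
      using gl_invariantD[OF T(1), of i "j p" "j0 p" j'] by simp
    also have "\<dots> = (\<Sum>k\<in>I. if k = p then T i j else 0)"
    proof (rule sum.cong)
      fix k assume k: "k \<in> I"
      have "T i (j'(k := j p)) = 0" if "k \<noteq> p" "j k = j0 p"
      proof (rule closer)
        \<comment> \<open>Injectivity of \<open>j0\<close> makes \<open>k\<close> a wrong position
          already, so overwriting it creates no new error, while the error at \<open>p\<close> has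
          been repaired.\<close>
        have "j k \<noteq> j0 k"
          using that inj k p by (auto dest: inj_onD)
        then show "{l \<in> I. (j'(k := j p)) l \<noteq> j0 l} \<subset> {l \<in> I. j l \<noteq> j0 l}"
          using p k that by (auto simp: j'_def split: if_splits)
      qed
      then show "of_bool (j' k = j0 p) * T i (j'(k := j p)) = (if k = p then T i j else 0)"
        by (auto simp: j'_def)
    qed simp
    also have "\<dots> = T i j"
      using p I by simp
    finally show ?thesis by simp
  qed
qed

section \<open>Permutation operators and the expansion of invariant tensors\<close>

lemma perm_entry_eq: "perm_entry n \<sigma> i j = of_bool (\<forall>k<n. i k = j (inv \<sigma> k))"
proof (cases "\<forall>k<n. i k = j (inv \<sigma> k)")
  case False
  then obtain k where "k < n" "i k \<noteq> j (inv \<sigma> k)" by blast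
  then show ?thesis
    using False unfolding perm_entry_def by (subst prod_zero) auto
qed (simp add: perm_entry_def)

lemma supported_on_perm_entry:
  assumes "\<sigma> permutes {..<n}"
  shows "supported_on {..<n} (perm_entry n \<sigma>)"
  using permutes_in_image[OF permutes_inv[OF assms]]
  by (auto simp: supported_on_def perm_entry_eq)

text \<open>After reindexing by \<open>inv \<sigma>\<close>, changing \<open>j\<close> at
  \<open>inv \<sigma> k\<close> and changing \<open>i\<close> at \<open>k\<close> impose the same
  conditions term by term.\<close>

lemma gl_invariant_perm_entry:
  assumes \<sigma>: "\<sigma> permutes {..<n}"
  shows "gl_invariant {..<n} (perm_entry n \<sigma>)"
  unfolding gl_invariant_def
proof (intro allI)
  fix i j :: "nat \<Rightarrow> 'a" and a b
  have inv: "inv \<sigma> permutes {..<n}" by (rule permutes_inv[OF \<sigma>])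
  have "(\<Sum>k<n. of_bool (j k = b) * perm_entry n \<sigma> i (j(k := a)))
      = (\<Sum>k<n. of_bool (j (inv \<sigma> k) = b) * perm_entry n \<sigma> i (j(inv \<sigma> k := a)))"
    by (rule sum.permute[OF inv, unfolded o_def])
  also have "\<dots> = (\<Sum>k<n. of_bool (i k = a) * perm_entry n \<sigma> (i(k := b)) j)"
  proof (rule sum.cong)
    fix k assume k: "k \<in> {..<n}"
    have "inv \<sigma> l = inv \<sigma> k \<longleftrightarrow> l = k" for l
      using permutes_inj[OF inv] by (auto dest: injD)
    then have "(\<forall>l<n. i l = (j(inv \<sigma> k := a)) (inv \<sigma> l)) \<longleftrightarrow> i k = a \<and> (\<forall>l<n. l \<noteq> k \<longrightarrow> i l = j (inv \<sigma> l))"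
      and "(\<forall>l<n. (i(k := b)) l = j (inv \<sigma> l)) \<longleftrightarrow> b = j (inv \<sigma> k) \<and> (\<forall>l<n. l \<noteq> k \<longrightarrow> i l = j (inv \<sigma> l))"
      using k by auto
    then show "of_bool (j (inv \<sigma> k) = b) * perm_entry n \<sigma> i (j(inv \<sigma> k := a))
        = of_bool (i k = a) * perm_entry n \<sigma> (i(k := b)) j"
      unfolding perm_entry_eq by auto
  qed simp
  finally show "(\<Sum>k<n. of_bool (i k = a) * perm_entry n \<sigma> (i(k := b)) j)
      = (\<Sum>k<n. of_bool (j k = b) * perm_entry n \<sigma> i (j(k := a)))" by simp
qed

text \<open>The entries at rows \<open>j0 \<circ> inv \<tau>\<close> of column \<open>j0\<close>
  form a dual system to the permutation operators; this gives linear independence and reads off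
  coefficients.\<close>

lemma perm_entry_inj:
  assumes "inj_on j0 {..<n}" "\<sigma> permutes {..<n}" "\<tau> permutes {..<n}"
  shows "perm_entry n \<sigma> (j0 \<circ> inv \<tau>) j0 = of_bool (\<sigma> = \<tau>)"
proof -
  have "\<sigma> = \<tau>" if *: "\<forall>k<n. j0 (inv \<tau> k) = j0 (inv \<sigma> k)"
  proof -
    have "inv \<tau> k = inv \<sigma> k" for k
    proof (cases "k < n")
      case True
      then show ?thesis
        using * permutes_in_image[OF permutes_inv[OF assms(2)], of k]
          permutes_in_image[OF permutes_inv[OF assms(3)], of k] inj_onD[OF assms(1)] by auto
    next
      case False
      then show ?thesis
        using permutes_not_in[OF permutes_inv[OF assms(2)], of k]
          permutes_not_in[OF permutes_inv[OF assms(3)], of k] by simp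
    qed
    then have "inv \<tau> = inv \<sigma>" by (rule ext)
    then have "inv (inv \<tau>) = inv (inv \<sigma>)" by (rule arg_cong)
    then show ?thesis
      using assms by (simp add: permutes_inv_inv)
  qed
  then show ?thesis by (auto simp: perm_entry_eq)
qed

text \<open>By the weight condition \<open>i\<close> takes each value as often as \<open>j0\<close>
  does. As \<open>j0\<close> is injective, \<open>i\<close> is \<open>j0\<close> composed with a
  permutation \<open>\<rho>\<close>, and \<open>\<sigma>\<close> is its inverse.\<close>

lemma gl_invariant_rearrangement:
  assumes T: "gl_invariant {..<n} T" and inj: "inj_on j0 {..<n}" and nz: "T i j0 \<noteq> 0"
  obtains \<sigma> where "\<sigma> permutes {..<n}" "\<And>k. k < n \<Longrightarrow> i k = j0 (inv \<sigma> k)"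
proof -
  have cards: "card {k \<in> {..<n}. i k = a} = card {k \<in> {..<n}. j0 k = a}" for a
    by (rule ccontr) (use gl_invariant_weight[OF T finite_lessThan, of i a j0] nz in simp)
  have fiber: "{k \<in> {..<n}. j0 k = j0 l} = {l}" if "l < n" for l
    using that inj by (intro equalityI subsetI) (auto dest: inj_onD)
  define \<rho> where "\<rho> k = (if k < n then inv_into {..<n} j0 (i k) else k)" for k
  have "i k \<in> j0 ` {..<n}" if "k < n" for k
  proof (rule ccontr)
    assume "i k \<notin> j0 ` {..<n}"
    then have empty: "{l \<in> {..<n}. j0 l = i k} = {}" by (simp add: image_iff) (metis lessThan_iff)
    have "card {l \<in> {..<n}. i l = i k} = 0" unfolding cards empty by simp
    then have "{l \<in> {..<n}. i l = i k} = {}" by simp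
    then show False using that by blast
  qed
  then have j0_\<rho>: "j0 (\<rho> k) = i k" and \<rho>_less: "\<rho> k < n" if "k < n" for k
    unfolding \<rho>_def using that f_inv_into_f[of "i k" j0 "{..<n}"] inv_into_into[of "i k" j0 "{..<n}"] by simp_all
  have "inj_on \<rho> {..<n}"
  proof (rule inj_onI)
    fix k l assume kl: "k \<in> {..<n}" "l \<in> {..<n}" "\<rho> k = \<rho> l"
    then have eq: "i k = i l" using j0_\<rho>[of k] j0_\<rho>[of l] by simp
    have "card {m \<in> {..<n}. i m = i k} = 1"
      unfolding cards using fiber[OF \<rho>_less[of k]] kl(1) by (simp add: j0_\<rho>)
    then obtain m where "{m \<in> {..<n}. i m = i k} = {m}"
      by (rule card_1_singletonE)
    moreover have "k \<in> {m \<in> {..<n}. i m = i k}" "l \<in> {m \<in> {..<n}. i m = i k}"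
      using kl eq by simp_all
    ultimately show "k = l" by (simp only: singleton_iff)
  qed
  then have "\<rho> permutes {..<n}"
  proof (rule inj_imp_permutes)
    show "\<rho> k \<in> {..<n}" if "k \<in> {..<n}" for k
      using that \<rho>_less[of k] by simp
    show "\<rho> k = k" if "k \<notin> {..<n}" for k
      using that by (simp add: \<rho>_def)
  qed simp
  then show ?thesis
    by (intro that[of "inv \<rho>"]) (simp_all add: permutes_inv permutes_inv_inv j0_\<rho>)
qed

text \<open>The difference \<open>R\<close> of both sides is invariant and vanishes on column
  \<open>j0\<close>: rows that rearrange \<open>j0\<close> are matched by the dual system, and all
  other rows give zero on both sides. By \<open>gl_invariant_eq_0\<close> it vanishes
  everywhere.\<close>

lemma perm_expansion:
  assumes T: "gl_invariant {..<n} T" "supported_on {..<n} T" and inj: "inj_on j0 {..<n}"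
  shows "T i j = (\<Sum>\<sigma> | \<sigma> permutes {..<n}. T (j0 \<circ> inv \<sigma>) j0 * perm_entry n \<sigma> i j)"
proof -
  let ?P = "{\<sigma>. \<sigma> permutes {..<n}}"
  define R where "R i j = T i j - (\<Sum>\<sigma>\<in>?P. T (j0 \<circ> inv \<sigma>) j0 * perm_entry n \<sigma> i j)" for i j
  have fin: "finite ?P" by (simp add: finite_permutations)
  have "gl_invariant {..<n} R"
    unfolding gl_invariant_def
  proof (intro allI)
    fix i j :: "nat \<Rightarrow> 'a" and a b
    have "(\<Sum>k<n. of_bool (i k = a) * (\<Sum>\<sigma>\<in>?P. T (j0 \<circ> inv \<sigma>) j0 * perm_entry n \<sigma> (i(k := b)) j))
        = (\<Sum>\<sigma>\<in>?P. T (j0 \<circ> inv \<sigma>) j0 * (\<Sum>k<n. of_bool (i k = a) * perm_entry n \<sigma> (i(k := b)) j))"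
      unfolding sum_distrib_left by (subst sum.swap) (simp add: mult_ac)
    also have "\<dots> = (\<Sum>\<sigma>\<in>?P. T (j0 \<circ> inv \<sigma>) j0 * (\<Sum>k<n. of_bool (j k = b) * perm_entry n \<sigma> i (j(k := a))))"
      by (intro sum.cong refl arg_cong2[where f = "(*)"] gl_invariantD gl_invariant_perm_entry) auto
    also have "\<dots> = (\<Sum>k<n. of_bool (j k = b) * (\<Sum>\<sigma>\<in>?P. T (j0 \<circ> inv \<sigma>) j0 * perm_entry n \<sigma> i (j(k := a))))"
      unfolding sum_distrib_left by (subst sum.swap) (simp add: mult_ac)
    finally show "(\<Sum>k<n. of_bool (i k = a) * R (i(k := b)) j) = (\<Sum>k<n. of_bool (j k = b) * R i (j(k := a)))"
      using gl_invariantD[OF T(1), of i a b j] by (simp add: R_def right_diff_distrib sum_subtractf)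
  qed
  moreover have "supported_on {..<n} R"
    unfolding supported_on_def
  proof (intro allI impI)
    fix i i' j j' :: "nat \<Rightarrow> 'a"
    assume *: "\<forall>k\<in>{..<n}. i k = i' k" "\<forall>k\<in>{..<n}. j k = j' k"
    have "T i j = T i' j'"
      using * by (intro supported_onD[OF T(2)]) auto
    moreover have "perm_entry n \<sigma> i j = perm_entry n \<sigma> i' j'" if "\<sigma> permutes {..<n}" for \<sigma>
      using * by (intro supported_onD[OF supported_on_perm_entry[OF that]]) auto
    ultimately show "R i j = R i' j'"
      by (simp add: R_def)
  qed
  moreover have "R i j0 = 0" for i
  proof (cases "\<exists>\<tau>. \<tau> permutes {..<n} \<and> (\<forall>k<n. i k = j0 (inv \<tau> k))")
    case True
    then obtain \<tau> where \<tau>: "\<tau> permutes {..<n}" "\<forall>k<n. i k = (j0 \<circ> inv \<tau>) k" by auto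
    have "T i j0 = T (j0 \<circ> inv \<tau>) j0"
      using \<tau> by (intro supported_onD[OF T(2)]) auto
    moreover have "perm_entry n \<sigma> i j0 = of_bool (\<sigma> = \<tau>)" if "\<sigma> permutes {..<n}" for \<sigma>
    proof -
      have "perm_entry n \<sigma> i j0 = perm_entry n \<sigma> (j0 \<circ> inv \<tau>) j0"
        using \<tau> by (simp add: perm_entry_eq)
      then show ?thesis using perm_entry_inj[OF inj that \<tau>(1)] by simp
    qed
    ultimately show ?thesis
      using fin \<tau>(1) by (simp add: R_def of_bool_def if_distrib[of "\<lambda>x. _ * x"] sum.delta cong: if_cong)
  next
    case False
    then have "T i j0 = 0"
      by (intro ccontr[of "T i j0 = 0"]) (auto elim!: gl_invariant_rearrangement[OF T(1) inj])
    moreover have "perm_entry n \<sigma> i j0 = 0" if "\<sigma> permutes {..<n}" for \<sigma>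
      using False that by (auto simp: perm_entry_eq)
    ultimately show ?thesis by (simp add: R_def)
  qed
  ultimately have "R i j = 0"
    using gl_invariant_eq_0[of "{..<n}" R j0 i j] inj by simp
  then show ?thesis by (simp add: R_def)
qed

text \<open>The equivalence contains existence and uniqueness together, so that the
  \<open>THE\<close> in the cumulant definitions can be evaluated.\<close>

lemma is_cumulant_family_iff:
  fixes T :: "(nat \<Rightarrow> 'n::finite) \<Rightarrow> (nat \<Rightarrow> 'n) \<Rightarrow> complex"
  assumes T: "gl_invariant {..<n} T" "supported_on {..<n} T" and inj: "inj_on j0 {..<n}"
  shows "is_cumulant_family n T c \<longleftrightarrow>
    c = (\<lambda>\<sigma>. if \<sigma> permutes {..<n} then of_nat CARD('n) powi int (perm_length n \<sigma>) * T (j0 \<circ> inv \<sigma>) j0 else 0)"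
    (is "_ \<longleftrightarrow> c = ?c")
proof
  let ?P = "{\<sigma>. \<sigma> permutes {..<n}}"
  have fin: "finite ?P" by (simp add: finite_permutations)
  have cancel: "(of_nat CARD('n) :: complex) powi (- int m) * (of_nat CARD('n) powi int m * x) = x" for m x
    by (simp add: power_int_minus)
  show "is_cumulant_family n T c" if "c = ?c"
    unfolding is_cumulant_family_def
  proof (intro conjI allI impI)
    show "c \<sigma> = 0" if "\<not> \<sigma> permutes {..<n}" for \<sigma>
      using that \<open>c = ?c\<close> by simp
    fix i j
    have "T i j = (\<Sum>\<sigma>\<in>?P. T (j0 \<circ> inv \<sigma>) j0 * perm_entry n \<sigma> i j)"
      by (rule perm_expansion[OF T inj])
    also have "\<dots> = (\<Sum>\<sigma>\<in>?P. of_nat CARD('n) powi (- int (perm_length n \<sigma>)) * c \<sigma> * perm_entry n \<sigma> i j)"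
      by (intro sum.cong refl) (simp only: \<open>c = ?c\<close> cancel mem_Collect_eq if_True)
    finally show "T i j = \<dots>" .
  qed
  assume c: "is_cumulant_family n T c"
  have "c \<sigma> = of_nat CARD('n) powi int (perm_length n \<sigma>) * T (j0 \<circ> inv \<sigma>) j0" if \<sigma>: "\<sigma> permutes {..<n}" for \<sigma>
  proof -
    have "T (j0 \<circ> inv \<sigma>) j0 = (\<Sum>\<tau>\<in>?P. of_nat CARD('n) powi (- int (perm_length n \<tau>)) * c \<tau>
        * perm_entry n \<tau> (j0 \<circ> inv \<sigma>) j0)"
      using c by (simp add: is_cumulant_family_def)
    also have "\<dots> = (\<Sum>\<tau>\<in>?P. if \<tau> = \<sigma> then of_nat CARD('n) powi (- int (perm_length n \<sigma>)) * c \<sigma> else 0)"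
      using \<sigma> by (intro sum.cong refl) (auto simp: perm_entry_inj[OF inj])
    also have "\<dots> = of_nat CARD('n) powi (- int (perm_length n \<sigma>)) * c \<sigma>"
      using fin \<sigma> by simp
    finally show ?thesis by (simp add: power_int_minus)
  qed
  then show "c = ?c"
    using c unfolding is_cumulant_family_def by (intro ext) simp
qed

section \<open>Factorization and cumulants\<close>

lemma supported_on_mult:
  "supported_on I S \<Longrightarrow> supported_on J T \<Longrightarrow> supported_on (I \<union> J) (\<lambda>i j. S i j * T i j)"
  unfolding supported_on_def by (metis UnCI)

text \<open>The Leibniz rule: a change of index in one of the disjoint sets leaves the factor of the
  other set untouched, so both sides split into two sums.\<close>

lemma gl_invariant_mult:
  assumes S: "gl_invariant I S" "supported_on I S" and T: "gl_invariant J T" "supported_on J T"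
    and fin: "finite I" "finite J" and disj: "I \<inter> J = {}"
  shows "gl_invariant (I \<union> J) (\<lambda>i j. S i j * T i j)"
  unfolding gl_invariant_def
proof (intro allI)
  fix i j :: "nat \<Rightarrow> 'a" and a b
  have S_upd: "S (f(k := x)) g = S f g" "S f (g(k := x)) = S f g" if "k \<in> J" for f g k x
    using that disj by (auto intro!: supported_onD[OF S(2)])
  have T_upd: "T (f(k := x)) g = T f g" "T f (g(k := x)) = T f g" if "k \<in> I" for f g k x
    using that disj by (auto intro!: supported_onD[OF T(2)])
  have "(\<Sum>k\<in>I \<union> J. of_bool (i k = a) * (S (i(k := b)) j * T (i(k := b)) j))
      = (\<Sum>k\<in>I. of_bool (i k = a) * S (i(k := b)) j) * T i j
        + S i j * (\<Sum>k\<in>J. of_bool (i k = a) * T (i(k := b)) j)"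
    using fin disj
    by (subst sum.union_disjoint)
      (auto simp: S_upd T_upd sum_distrib_left sum_distrib_right mult_ac
        simp del: sum_of_bool_mult_eq sum_mult_of_bool_eq intro!: arg_cong2[where f = "(+)"] sum.cong)
  moreover have "(\<Sum>k\<in>I \<union> J. of_bool (j k = b) * (S i (j(k := a)) * T i (j(k := a))))
      = (\<Sum>k\<in>I. of_bool (j k = b) * S i (j(k := a))) * T i j
        + S i j * (\<Sum>k\<in>J. of_bool (j k = b) * T i (j(k := a)))"
    using fin disj
    by (subst sum.union_disjoint)
      (auto simp: S_upd T_upd sum_distrib_left sum_distrib_right mult_ac
        simp del: sum_of_bool_mult_eq sum_mult_of_bool_eq intro!: arg_cong2[where f = "(+)"] sum.cong)
  ultimately show "(\<Sum>k\<in>I \<union> J. of_bool (i k = a) * (S (i(k := b)) j * T (i(k := b)) j))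
      = (\<Sum>k\<in>I \<union> J. of_bool (j k = b) * (S i (j(k := a)) * T i (j(k := a))))"
    by (simp only: gl_invariantD[OF S(1)] gl_invariantD[OF T(1)])
qed

lemma cumulant_the_eq:
  fixes T :: "(nat \<Rightarrow> 'n::finite) \<Rightarrow> (nat \<Rightarrow> 'n) \<Rightarrow> complex"
  assumes "gl_invariant {..<n} T" "supported_on {..<n} T" "inj_on j0 {..<n}" "\<sigma> permutes {..<n}"
  shows "(THE c. is_cumulant_family n T c) \<sigma> = of_nat CARD('n) powi int (perm_length n \<sigma>) * T (j0 \<circ> inv \<sigma>) j0"
  unfolding is_cumulant_family_iff[OF assms(1-3)] the_eq_trivial using assms(4) by simp

text \<open>Any injective \<open>j0\<close> may be chosen, which later allows a shifted copy for the
  second block.\<close>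

lemma mat_cumulant_eq:
  fixes M :: "nat \<Rightarrow> 'n::finite cmat"
  assumes "inj_on j0 {..<n}" "\<sigma> permutes {..<n}"
  shows "mat_cumulant M n \<sigma>
    = of_nat CARD('n) powi int (perm_length n \<sigma>) * conj_tensor {..<n} M (j0 \<circ> inv \<sigma>) j0"
proof -
  have "mat_cumulant M n = (THE c. is_cumulant_family n (conj_tensor {..<n} M) c)"
    unfolding mat_cumulant_def conj_tensor_def ..
  then show ?thesis
    using cumulant_the_eq[OF gl_invariant_conj_tensor supported_on_conj_tensor assms] by simp
qed

lemma integrable_haar_pair_continuous:
  fixes f :: "'n::finite cmat \<times> 'n cmat \<Rightarrow> complex"
  assumes "continuous_on UNIV f"
  shows "integrable (haar_unitary \<Otimes>\<^sub>M haar_unitary) f"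
proof -
  let ?H = "haar_unitary :: 'n cmat measure"
  let ?K = "{U :: 'n cmat. unitary_mat U} \<times> {U :: 'n cmat. unitary_mat U}"
  interpret H: prob_space ?H by (rule prob_space_haar_unitary)
  interpret P: pair_prob_space ?H ?H ..
  have "bounded (f ` ?K)"
    by (intro compact_imp_bounded compact_continuous_image compact_Times compact_unitary
        continuous_on_subset[OF assms]) auto
  then obtain K where K: "\<And>p. p \<in> ?K \<Longrightarrow> norm (f p) \<le> K"
    by (auto simp: bounded_iff)
  have "AE p in ?H \<Otimes>\<^sub>M ?H. unitary_mat (fst p) \<and> unitary_mat (snd p)"
  proof (rule P.AE_pair_measure)
    show "{p \<in> space (?H \<Otimes>\<^sub>M ?H). unitary_mat (fst p) \<and> unitary_mat (snd p)} \<in> sets (?H \<Otimes>\<^sub>M ?H)"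
      by measurable
    show "AE U in ?H. AE V in ?H. unitary_mat (fst (U, V)) \<and> unitary_mat (snd (U, V))"
      using AE_haar_unitary by eventually_elim (use AE_haar_unitary in simp)
  qed
  then have "AE p in ?H \<Otimes>\<^sub>M ?H. norm (f p) \<le> K"
    by eventually_elim (auto intro!: K)
  moreover have "f \<in> borel_measurable (?H \<Otimes>\<^sub>M ?H)"
    using borel_measurable_continuous_onI[OF assms] unfolding borel_prod[symmetric]
    by (simp cong: measurable_cong_sets sets_pair_measure_cong)
  ultimately show ?thesis
    by (rule P.P.integrable_const_bound)
qed

section \<open>Tensor products of permutations and their cycles\<close>

lemma perm_tensor_simps:
  "i < m \<Longrightarrow> perm_tensor m \<sigma>1 \<sigma>2 i = \<sigma>1 i" "perm_tensor m \<sigma>1 \<sigma>2 (m + i) = m + \<sigma>2 i"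
  by (simp_all add: perm_tensor_def)

lemma perm_tensor_inverse:
  assumes "\<And>i. i < m \<Longrightarrow> \<tau>1 i < m" "\<And>i. \<sigma>1 (\<tau>1 i) = i" "\<And>i. \<sigma>2 (\<tau>2 i) = i"
  shows "perm_tensor m \<sigma>1 \<sigma>2 (perm_tensor m \<tau>1 \<tau>2 i) = i"
  using assms by (simp add: perm_tensor_def)

lemma
  assumes \<sigma>1: "\<sigma>1 permutes {..<m}" and \<sigma>2: "\<sigma>2 permutes {..<n - m}" and m: "m \<le> n"
  shows perm_tensor_permutes: "perm_tensor m \<sigma>1 \<sigma>2 permutes {..<n}"
    and inv_perm_tensor: "inv (perm_tensor m \<sigma>1 \<sigma>2) = perm_tensor m (inv \<sigma>1) (inv \<sigma>2)"
proof -
  have less1: "\<sigma>1 i < m" "inv \<sigma>1 i < m" if "i < m" for i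
    using that permutes_in_image[OF \<sigma>1, of i] permutes_in_image[OF permutes_inv[OF \<sigma>1], of i] by auto
  have left: "perm_tensor m (inv \<sigma>1) (inv \<sigma>2) (perm_tensor m \<sigma>1 \<sigma>2 i) = i" for i
    by (rule perm_tensor_inverse) (simp_all add: less1 permutes_inverses[OF \<sigma>1] permutes_inverses[OF \<sigma>2])
  have right: "perm_tensor m \<sigma>1 \<sigma>2 (perm_tensor m (inv \<sigma>1) (inv \<sigma>2) i) = i" for i
    by (rule perm_tensor_inverse) (simp_all add: less1 permutes_inverses[OF \<sigma>1] permutes_inverses[OF \<sigma>2])
  show "inv (perm_tensor m \<sigma>1 \<sigma>2) = perm_tensor m (inv \<sigma>1) (inv \<sigma>2)"
    by (rule inv_equality[OF left right])
  have "perm_tensor m \<sigma>1 \<sigma>2 i = i" if "i \<notin> {..<n}" for i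
    using that m permutes_not_in[OF \<sigma>2, of "i - m"] by (simp add: perm_tensor_def)
  then show "perm_tensor m \<sigma>1 \<sigma>2 permutes {..<n}"
    unfolding permutes_def using left right by metis
qed

text \<open>The orbits are those of \<open>\<sigma>1\<close> together with the shifted orbits of
  \<open>\<sigma>2\<close>, so cycle counts add.\<close>

lemma perm_length_perm_tensor:
  assumes \<sigma>1: "\<sigma>1 permutes {..<m}" and m: "m \<le> n"
  shows "perm_length n (perm_tensor m \<sigma>1 \<sigma>2) = perm_length m \<sigma>1 + perm_length (n - m) \<sigma>2"
proof -
  let ?\<rho> = "perm_tensor m \<sigma>1 \<sigma>2"
  have less: "\<sigma>1 i < m" if "i < m" for i
    using that permutes_in_image[OF \<sigma>1, of i] by simp
  have pow1: "(?\<rho> ^^ r) i = (\<sigma>1 ^^ r) i \<and> (\<sigma>1 ^^ r) i < m" if "i < m" for i r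
    using that by (induction r) (auto simp: perm_tensor_simps less)
  have pow2: "(?\<rho> ^^ r) (m + i) = m + (\<sigma>2 ^^ r) i" for i r
    by (induction r) (auto simp: perm_tensor_simps)
  have orb1: "orbit ?\<rho> i = orbit \<sigma>1 i" if "i < m" for i
    using pow1[OF that] by (simp add: orbit_altdef)
  have orb2: "orbit ?\<rho> (m + i) = (+) m ` orbit \<sigma>2 i" for i
    by (auto simp: orbit_altdef pow2)
  have split: "{..<n} = {..<m} \<union> (+) m ` {..<n - m}"
    using m by (auto simp: lessThan_atLeast0)
  have "orbit ?\<rho> ` {..<n} = orbit \<sigma>1 ` {..<m} \<union> (`) ((+) m) ` orbit \<sigma>2 ` {..<n - m}"
    by (simp add: split image_Un image_image orb1 orb2)
  moreover have "orbit \<sigma>1 ` {..<m} \<inter> (`) ((+) m) ` orbit \<sigma>2 ` {..<n - m} = {}"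
  proof (rule ccontr)
    assume "orbit \<sigma>1 ` {..<m} \<inter> (`) ((+) m) ` orbit \<sigma>2 ` {..<n - m} \<noteq> {}"
    then obtain i l where "i < m" "orbit \<sigma>1 i = (+) m ` orbit \<sigma>2 l" by auto
    \<comment> \<open>An orbit contains the image of its base point; here this image is below
      \<open>m\<close>, but shifted orbits lie at or above \<open>m\<close>.\<close>
    then have "\<sigma>1 i \<in> (+) m ` orbit \<sigma>2 l"
      using orbit.base[of \<sigma>1 i] by simp
    then show False using less[OF \<open>i < m\<close>] by auto
  qed
  moreover have "inj_on ((`) ((+) m)) X" for X :: "nat set set"
    by (auto simp: inj_on_def inj_image_eq_iff)
  ultimately have "num_cycles n ?\<rho> = num_cycles m \<sigma>1 + num_cycles (n - m) \<sigma>2"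
    by (simp add: num_cycles_def card_Un_disjoint card_image)
  \<comment> \<open>Needed because \<open>perm_length\<close> uses truncated subtraction on
    naturals.\<close>
  moreover have "num_cycles r \<tau> \<le> r" for r \<tau>
    unfolding num_cycles_def using card_image_le[of "{..<r}" "orbit \<tau>"] by simp
  note this[of m \<sigma>1] this[of "n - m" \<sigma>2]
  ultimately show ?thesis
    using m by (simp add: perm_length_def)
qed

lemma conj_tensor_shift:
  assumes "m \<le> n"
  shows "conj_tensor {m..<n} M i j = conj_tensor {..<n - m} (\<lambda>k. M (m + k)) (\<lambda>k. i (m + k)) (\<lambda>k. j (m + k))"
proof -
  have "(\<Prod>k=m..<n. f k) = (\<Prod>k<n - m. f (m + k))" for f :: "nat \<Rightarrow> complex"
    using prod.shift_bounds_nat_ivl[of f 0 m "n - m"] assms by (simp add: atLeast0LessThan add.commute)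
  then show ?thesis by (simp add: conj_tensor_def)
qed

text \<open>With \<open>U\<close> the first and \<open>V\<close> the second component, the
  \<open>B\<close> factors see only \<open>V ** U\<close> and the \<open>A\<close> factors only
  \<open>V\<close>. Integrating over \<open>U\<close> first, left invariance removes
  \<open>V\<close> from the \<open>B\<close> part, and the expectation factorizes.\<close>

lemma exp_conj_tensor_eq:
  fixes A B :: "nat \<Rightarrow> 'n::finite cmat"
  shows "(\<integral>p. (\<Prod>k<n. (snd p ** (if fromA k then A k else fst p ** B k ** cadj (fst p)) ** cadj (snd p)) $ i k $ j k)
      \<partial>(haar_unitary \<Otimes>\<^sub>M haar_unitary))
    = conj_tensor {k \<in> {..<n}. fromA k} A i j * conj_tensor {k \<in> {..<n}. \<not> fromA k} B i j"
    (is "integral\<^sup>L _ ?f = _")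
proof -
  let ?H = "haar_unitary :: 'n cmat measure"
  let ?a = "\<lambda>V. \<Prod>k\<in>{k \<in> {..<n}. fromA k}. (V ** A k ** cadj V) $ i k $ j k"
  let ?b = "\<lambda>W. \<Prod>k\<in>{k \<in> {..<n}. \<not> fromA k}. (W ** B k ** cadj W) $ i k $ j k"
  interpret H: prob_space ?H by (rule prob_space_haar_unitary)
  interpret P: pair_prob_space ?H ?H ..
  have f: "?f (U, V) = ?a V * ?b (V ** U)" for U V
  proof -
    have split: "{..<n} = {k \<in> {..<n}. fromA k} \<union> {k \<in> {..<n}. \<not> fromA k}" by auto
    have "?f (U, V) = (\<Prod>k\<in>{k \<in> {..<n}. fromA k} \<union> {k \<in> {..<n}. \<not> fromA k}.
        (V ** (if fromA k then A k else U ** B k ** cadj U) ** cadj V) $ i k $ j k)"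
      by (rule prod.cong[OF split]) simp
    also have "\<dots> = ?a V * ?b (V ** U)"
      by (subst prod.union_disjoint) (auto simp: cadj_matrix_mult matrix_mul_assoc)
    finally show ?thesis .
  qed
  have "integrable (?H \<Otimes>\<^sub>M ?H) (\<lambda>p. ?f (fst p, snd p))"
    unfolding f by (intro integrable_haar_pair_continuous continuous_intros)
  then have "integrable (?H \<Otimes>\<^sub>M ?H) (case_prod (\<lambda>U V. ?f (U, V)))"
    by (simp add: case_prod_beta')
  from P.integral_snd[OF this]
  have "integral\<^sup>L (?H \<Otimes>\<^sub>M ?H) ?f = (\<integral>V. \<integral>U. ?f (U, V) \<partial>?H \<partial>?H)"
    by (simp add: case_prod_beta' cong: if_cong)
  also have "\<dots> = (\<integral>V. ?a V * (\<integral>U. ?b (V ** U) \<partial>?H) \<partial>?H)"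
    unfolding f by simp
  also have "\<dots> = (\<integral>V. ?a V * conj_tensor {k \<in> {..<n}. \<not> fromA k} B i j \<partial>?H)"
  proof (rule integral_cong_AE)
    have "AE V in ?H. (\<integral>U. ?b (V ** U) \<partial>?H) = conj_tensor {k \<in> {..<n}. \<not> fromA k} B i j"
      using AE_haar_unitary
    proof eventually_elim
      case (elim V)
      show ?case
        unfolding conj_tensor_def
        by (rule integral_haar_left_invariant[OF elim])
          (intro borel_measurable_continuous_onI continuous_intros)
    qed
    then show "AE V in ?H. ?a V * (\<integral>U. ?b (V ** U) \<partial>?H) = ?a V * conj_tensor {k \<in> {..<n}. \<not> fromA k} B i j"
      by eventually_elim simp
    show "(\<lambda>V. ?a V * (\<integral>U. ?b (V ** U) \<partial>?H)) \<in> borel_measurable ?H" by measurable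
    show "(\<lambda>V. ?a V * conj_tensor {k \<in> {..<n}. \<not> fromA k} B i j) \<in> borel_measurable ?H" by measurable
  qed
  finally show ?thesis by (simp add: conj_tensor_def)
qed

theorem theorem5p4:
  fixes A B :: "nat \<Rightarrow> 'n::finite cmat"
    and k l n :: nat
    and fromA :: "nat \<Rightarrow> bool" and c :: "nat \<Rightarrow> nat"
  assumes N_ge: "n \<le> CARD('n)"
    and idxA: "\<And>i. i < n \<Longrightarrow> fromA i \<Longrightarrow> c i < k"
    and idxB: "\<And>i. i < n \<Longrightarrow> \<not> fromA i \<Longrightarrow> c i < l"
  defines "C \<equiv> (\<lambda>U i. if fromA i then A (c i) else U ** B (c i) ** cadj U)"
  shows
    "(\<forall>\<sigma> i j. \<sigma> permutes {..<n} \<and> i < n \<and> j < n \<and> i \<noteq> j \<and> j \<in> orbit \<sigma> i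
        \<and> fromA i \<and> \<not> fromA j
        \<longrightarrow> exp_mat_cumulant haar_unitary C n \<sigma> = 0)
   \<and> (\<forall>m \<sigma>1 \<sigma>2. m \<le> n \<and> \<sigma>1 permutes {..<m} \<and> \<sigma>2 permutes {..<n - m}
        \<and> (\<forall>i<m. fromA i) \<and> (\<forall>j. m \<le> j \<and> j < n \<longrightarrow> \<not> fromA j)
        \<longrightarrow> exp_mat_cumulant haar_unitary C n (perm_tensor m \<sigma>1 \<sigma>2)
            = mat_cumulant (\<lambda>i. A (c i)) m \<sigma>1 * mat_cumulant (\<lambda>i. B (c (m + i))) (n - m) \<sigma>2)"
proof -
  define SA where "SA = {k \<in> {..<n}. fromA k}"
  define SB where "SB = {k \<in> {..<n}. \<not> fromA k}"
  define TA where "TA = conj_tensor SA (\<lambda>i. A (c i))"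
  define TB where "TB = conj_tensor SB (\<lambda>i. B (c i))"
  have S: "finite SA" "finite SB" "SA \<inter> SB = {}" and S_Un: "SA \<union> SB = {..<n}"
    by (auto simp: SA_def SB_def)
  \<comment> \<open>This is where \<open>n \<le> CARD('n)\<close> enters: there must be
    \<open>n\<close> distinct basis indices.\<close>
  obtain j0 :: "nat \<Rightarrow> 'n" where j0: "inj_on j0 {..<n}"
    using card_le_inj[of "{..<n}" "UNIV :: 'n set"] N_ge by auto
  have "(\<lambda>i j. \<integral>p. (\<Prod>k<n. (snd p ** C (fst p) k ** cadj (snd p)) $ i k $ j k)
      \<partial>(haar_unitary \<Otimes>\<^sub>M haar_unitary)) = (\<lambda>i j. TA i j * TB i j)"
    unfolding C_def TA_def TB_def SA_def SB_def exp_conj_tensor_eq[symmetric] ..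
  then have "exp_mat_cumulant haar_unitary C n = (THE c. is_cumulant_family n (\<lambda>i j. TA i j * TB i j) c)"
    by (simp add: exp_mat_cumulant_def)
  moreover have "gl_invariant {..<n} (\<lambda>i j. TA i j * TB i j)"
    unfolding S_Un[symmetric] TA_def TB_def
    by (intro gl_invariant_mult gl_invariant_conj_tensor supported_on_conj_tensor S)
  moreover have "supported_on {..<n} (\<lambda>i j. TA i j * TB i j)"
    unfolding S_Un[symmetric] TA_def TB_def
    by (intro supported_on_mult supported_on_conj_tensor)
  ultimately have exp_eq: "exp_mat_cumulant haar_unitary C n \<sigma>
      = of_nat CARD('n) powi int (perm_length n \<sigma>) * (TA (j0 \<circ> inv \<sigma>) j0 * TB (j0 \<circ> inv \<sigma>) j0)"
    if "\<sigma> permutes {..<n}" for \<sigma>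
    using cumulant_the_eq[OF _ _ j0 that] by metis
  show ?thesis
  proof (intro conjI allI impI; elim conjE)
    fix \<sigma> i j
    assume \<sigma>: "\<sigma> permutes {..<n}" and ij: "i < n" "j < n" "j \<in> orbit \<sigma> i" "fromA i" "\<not> fromA j"
    \<comment> \<open>If \<open>SA\<close> were closed under \<open>\<sigma>\<close>, the orbit of
      \<open>i\<close> would stay inside it and could not reach \<open>j\<close>.\<close>
    have "\<exists>p\<in>SA. \<sigma> p \<notin> SA"
    proof (rule ccontr)
      assume closed: "\<not> (\<exists>p\<in>SA. \<sigma> p \<notin> SA)"
      have "i \<in> SA" using ij by (simp add: SA_def)
      from ij(3) have "j \<in> SA"
        by induction (use closed \<open>i \<in> SA\<close> in blast)+
      then show False using ij by (simp add: SA_def)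
    qed
    then obtain p where p: "p \<in> SA" "\<sigma> p \<notin> SA" by blast
    \<comment> \<open>On \<open>SA\<close> the value \<open>j0 p\<close> is taken by
      \<open>j0\<close> at \<open>p\<close>, but never by \<open>j0 \<circ> inv \<sigma>\<close>,
      since that would force \<open>k = \<sigma> p\<close>, outside \<open>SA\<close>. The weights
      differ and the \<open>A\<close> factor vanishes.\<close>
    have "card {k \<in> SA. (j0 \<circ> inv \<sigma>) k = j0 p} = 0"
    proof -
      have False if k: "k \<in> SA" "j0 (inv \<sigma> k) = j0 p" for k
      proof -
        have "inv \<sigma> k = p"
          using k p permutes_in_image[OF permutes_inv[OF \<sigma>], of k]
          by (intro inj_onD[OF j0 k(2)]) (auto simp: SA_def)
        then have "k = \<sigma> p" using permutes_inverses(1)[OF \<sigma>, of k] by simp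
        then show False using k p by simp
      qed
      then have "{k \<in> SA. (j0 \<circ> inv \<sigma>) k = j0 p} = {}" by auto
      then show ?thesis by (simp only: card.empty)
    qed
    moreover have "card {k \<in> SA. j0 k = j0 p} \<noteq> 0"
      using p S(1) by auto
    ultimately have "TA (j0 \<circ> inv \<sigma>) j0 = 0"
      unfolding TA_def
      by (intro gl_invariant_weight[OF gl_invariant_conj_tensor, where a = "j0 p"] S) (simp only: not_False_eq_True)
    then show "exp_mat_cumulant haar_unitary C n \<sigma> = 0"
      by (simp add: exp_eq[OF \<sigma>])
  next
    fix m \<sigma>1 \<sigma>2
    assume m: "m \<le> n" and \<sigma>: "\<sigma>1 permutes {..<m}" "\<sigma>2 permutes {..<n - m}"
      and src: "\<forall>i<m. fromA i" "\<forall>j. m \<le> j \<and> j < n \<longrightarrow> \<not> fromA j"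
    let ?\<rho> = "perm_tensor m \<sigma>1 \<sigma>2" and ?j1 = "\<lambda>k. j0 (m + k)"
    note \<rho> = perm_tensor_permutes[OF \<sigma> m]
    have SA: "SA = {..<m}" and SB: "SB = {m..<n}"
      using src m by (auto simp: SA_def SB_def not_less[symmetric])
    have "inj_on j0 {..<m}"
      using m by (intro inj_on_subset[OF j0]) auto
    note eq1 = mat_cumulant_eq[OF this \<sigma>(1)]
    have "inj_on ?j1 {..<n - m}"
    proof (rule inj_onI)
      fix x y assume "x \<in> {..<n - m}" "y \<in> {..<n - m}" "?j1 x = ?j1 y"
      then have "m + x = m + y" by (intro inj_onD[OF j0]) auto
      then show "x = y" by simp
    qed
    note eq2 = mat_cumulant_eq[OF this \<sigma>(2)]
    \<comment> \<open>Both blocks are evaluated at restrictions of the same \<open>j0\<close>, the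
      second one shifted by \<open>m\<close>, so the two factors are exactly those in the formulas
      for the separate cumulants.\<close>
    have TA: "TA (j0 \<circ> inv ?\<rho>) j0 = conj_tensor {..<m} (\<lambda>i. A (c i)) (j0 \<circ> inv \<sigma>1) j0"
      unfolding TA_def SA inv_perm_tensor[OF \<sigma> m]
      by (rule conj_tensor_cong) (simp_all add: perm_tensor_simps)
    have TB: "TB (j0 \<circ> inv ?\<rho>) j0 = conj_tensor {..<n - m} (\<lambda>i. B (c (m + i))) (?j1 \<circ> inv \<sigma>2) ?j1"
      unfolding TB_def SB inv_perm_tensor[OF \<sigma> m] conj_tensor_shift[OF m]
      by (rule conj_tensor_cong) (simp_all add: perm_tensor_simps)
    show "exp_mat_cumulant haar_unitary C n ?\<rho>
        = mat_cumulant (\<lambda>i. A (c i)) m \<sigma>1 * mat_cumulant (\<lambda>i. B (c (m + i))) (n - m) \<sigma>2"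
      unfolding exp_eq[OF \<rho>] eq1 eq2 TA TB perm_length_perm_tensor[OF \<sigma>(1) m]
      by (simp add: power_int_add)
  qed
qed

end
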